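(* Let $X$ be a separable symmetric space on $[0,1]$ and let $f\in X$ satisfy $f=f^*$. Suppose the system $\{V^\alpha f\}_{\alpha\in\mathbb{A}}$ is an absolutely representing system in $X$ with constant $C$, i.e. for every $x\in X$ there exist real coefficients $\{\xi_\alpha\}_{\alpha\in\mathbb{A}}$ with $x=\sum_{k=0}^\infty\sum_{|\alpha|=k}\xi_\alpha V^\alpha f$ in $X$ and $\sum_{k=0}^\infty\bigl\|\sum_{|\alpha|=k}\xi_\alpha V^\alpha f\bigr\|_X\le C\|x\|_X$. Then $$\|\sigma_tf\|_X\le 2C\Bigl|\int_0^1f(s)\,ds\Bigr|\,\phi_X(t),\qquad 0<t\le1.$$
   Context: A symmetric space $X$ on $[0,1]$ is a Banach space of (equivalence classes of) real-valued Lebesgue measurable functions on $[0,1]$ such that: (a) if $y\in X$ and $x$ is measurable with $|x|\le|y|$ a.e., then $x\in X$ and $\|x\|_X\le\|y\|_X$; (b) if $x,y$ are equimeasurable and $y\in X$, then $x\in X$ and $\|x\|_X=\|y\|_X$; normalized so that $\|\chi_{[0,1]}\|_X=1$. $x^*$ denotes the decreasing right-continuous rearrangement of $|x|$, $x^*(t)=\inf\{s\ge0: m\{|x|>s\}\le t\}$; so $f=f^*$ means $f$ is nonnegative, nonincreasing and right-continuous. The fundamental function is $\phi_X(t)=\|\chi_{[0,t]}\|_X$. The dilation operator is $\sigma_\tau x(t)=x(t/\tau)\chi_{(0,\min(1,\tau))}(t)$. For $f\in L_1[0,1]$: $V_0f(t)=f(2t)$ on $[0,\frac12]$, $0$ on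 $(\frac12,1]$; $V_1f(t)=0$ on $[0,\frac12)$, $f(2t-1)$ on $[\frac12,1]$. $\mathbb{A}=\bigcup_{k\ge0}\{0,1\}^k$; for $\alpha=(\alpha_1,\dots,\alpha_k)$, $|\alpha|=k$, $V^\alpha f=V_{\alpha_1}\cdots V_{\alpha_k}f$ (identity for $k=0$), i.e. $V^\alpha f(t)=f(2^kt-i)$ on $[i2^{-k},(i+1)2^{-k}]$, $0$ elsewhere, $i=\sum\alpha_\nu2^{k-\nu}$. *)

theory Defs
  imports "HOL-Analysis.Analysis"
begin

text \<open>Functions on [0,1] are represented as real => real; only values on [0,1]
  matter (all conditions are up to a.e. equality w.r.t. Lebesgue measure on [0,1]).\<close>

definition M01 :: "real measure" where
  "M01 = lebesgue_on {0..1}"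

definition equimeasurable :: "(real \<Rightarrow> real) \<Rightarrow> (real \<Rightarrow> real) \<Rightarrow> bool" where
  "equimeasurable x y \<longleftrightarrow>
     (\<forall>s. measure M01 {t \<in> space M01. x t > s} = measure M01 {t \<in> space M01. y t > s})"

definition symmetric_space :: "(real \<Rightarrow> real) set \<Rightarrow> ((real \<Rightarrow> real) \<Rightarrow> real) \<Rightarrow> bool" where
  "symmetric_space X N \<longleftrightarrow>
     X \<subseteq> borel_measurable M01 \<and>
     (\<forall>x\<in>X. \<forall>y\<in>X. (\<lambda>t. x t + y t) \<in> X) \<and>
     (\<forall>x\<in>X. \<forall>c::real. (\<lambda>t. c * x t) \<in> X) \<and>
     (\<forall>x\<in>X. N x \<ge> 0) \<and>
     (\<forall>x\<in>X. N x = 0 \<longleftrightarrow> (AE t in M01. x t = 0)) \<and>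
     (\<forall>x\<in>X. \<forall>y\<in>X. N (\<lambda>t. x t + y t) \<le> N x + N y) \<and>
     (\<forall>x\<in>X. \<forall>c::real. N (\<lambda>t. c * x t) = \<bar>c\<bar> * N x) \<and>
     (\<forall>u::nat \<Rightarrow> real \<Rightarrow> real. (\<forall>n. u n \<in> X) \<and>
        (\<forall>e>0. \<exists>K. \<forall>m\<ge>K. \<forall>n\<ge>K. N (\<lambda>t. u m t - u n t) < e)
        \<longrightarrow> (\<exists>x\<in>X. (\<lambda>n. N (\<lambda>t. u n t - x t)) \<longlonglongrightarrow> 0)) \<and>
     (\<forall>x y. y \<in> X \<and> x \<in> borel_measurable M01 \<and> (AE t in M01. \<bar>x t\<bar> \<le> \<bar>y t\<bar>)
        \<longrightarrow> x \<in> X \<and> N x \<le> N y) \<and>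
     (\<forall>x y. y \<in> X \<and> x \<in> borel_measurable M01 \<and> equimeasurable x y
        \<longrightarrow> x \<in> X \<and> N x = N y) \<and>
     N (indicator {0..1}) = 1"

definition separable_symm :: "(real \<Rightarrow> real) set \<Rightarrow> ((real \<Rightarrow> real) \<Rightarrow> real) \<Rightarrow> bool" where
  "separable_symm X N \<longleftrightarrow>
     (\<exists>D. countable D \<and> D \<subseteq> X \<and> (\<forall>x\<in>X. \<forall>e>0. \<exists>d\<in>D. N (\<lambda>t. x t - d t) < e))"

definition drearr :: "(real \<Rightarrow> real) \<Rightarrow> real \<Rightarrow> real" where
  "drearr x t = Inf {s. s \<ge> 0 \<and> measure M01 {u \<in> space M01. \<bar>x u\<bar> > s} \<le> t}"

definition fundamental :: "((real \<Rightarrow> real) \<Rightarrow> real) \<Rightarrow> real \<Rightarrow> real" where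
  "fundamental N t = N (indicator {0..t})"

definition dil :: "real \<Rightarrow> (real \<Rightarrow> real) \<Rightarrow> real \<Rightarrow> real" where
  "dil \<tau> x t = (if 0 < t \<and> t < min 1 \<tau> then x (t / \<tau>) else 0)"

definition V0 :: "(real \<Rightarrow> real) \<Rightarrow> real \<Rightarrow> real" where
  "V0 f t = (if 0 \<le> t \<and> t \<le> 1/2 then f (2 * t) else 0)"

definition V1 :: "(real \<Rightarrow> real) \<Rightarrow> real \<Rightarrow> real" where
  "V1 f t = (if 1/2 \<le> t \<and> t \<le> 1 then f (2 * t - 1) else 0)"

fun Valpha :: "bool list \<Rightarrow> (real \<Rightarrow> real) \<Rightarrow> real \<Rightarrow> real" where
  "Valpha [] f = f"
| "Valpha (a # as) f = (if a then V1 else V0) (Valpha as f)"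

definition level_sum :: "(bool list \<Rightarrow> real) \<Rightarrow> (real \<Rightarrow> real) \<Rightarrow> nat \<Rightarrow> real \<Rightarrow> real" where
  "level_sum \<xi> f k t = (\<Sum>\<alpha>\<in>{\<alpha>::bool list. length \<alpha> = k}. \<xi> \<alpha> * Valpha \<alpha> f t)"

definition abs_representing :: "(real \<Rightarrow> real) set \<Rightarrow> ((real \<Rightarrow> real) \<Rightarrow> real) \<Rightarrow> (real \<Rightarrow> real) \<Rightarrow> real \<Rightarrow> bool" where
  "abs_representing X N f C \<longleftrightarrow>
     (\<forall>x\<in>X. \<exists>\<xi>::bool list \<Rightarrow> real.
        (\<forall>k. level_sum \<xi> f k \<in> X) \<and>
        (\<lambda>n. N (\<lambda>t. x t - (\<Sum>k<n. level_sum \<xi> f k t))) \<longlonglongrightarrow> 0 \<and>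
        summable (\<lambda>k. N (level_sum \<xi> f k)) \<and>
        (\<Sum>k. N (level_sum \<xi> f k)) \<le> C * N x)"

end

theory Submission
  imports Defs "HOL-Number_Theory.Cong" "HOL-Probability.Weak_Convergence"
begin

text \<open>
  Let $t = 2^{-n}$ and $E = [1 - t, 1]$, represent $\chi_E = \sum_k L_k$, where $L_k$ is the
  $k$-th level sum, and integrate over $E$. It suffices that
  $\|\sigma_t f\| \, |\int_E L_k| \le t \int f \, \|L_k\|$ for every $k$.
  If $k < n$, then $E$ lies in the last dyadic interval of length $2^{-k}$, where $L_k$ is a
  multiple of a compressed copy of $f$; the mean of a decreasing function over a right end segment
  is at most its total mean. (This is why $E$ sits at the right end of the unit interval.)
  If $k \ge n$, replacing the coefficients of the dyadic intervals inside $E$ by the average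
  of their absolute values does not increase the norm, because this average is a mean of cyclic
  permutations, each giving an equimeasurable function; the averaged function is equimeasurable
  with a multiple of $\sigma_t f$. The same averaging, applied to an increasing rearrangement,
  turns the values of a function into its Riemann sums, so that the $X$-norm dominates the
  $L_1$-norm and the series may be integrated termwise.
  The factor 2 comes from passing to an arbitrary $t$ through $\phi_X(2t) \le 2 \phi_X(t)$.
\<close>

subsection \<open>The probability space [0,1]\<close>

lemma space_M01: "space M01 = {0..1}"
  by (simp add: M01_def)

lemma prob_space_M01: "prob_space M01"
  unfolding M01_def by (rule prob_spaceI) (simp add: emeasure_restrict_space)

interpretation M01: prob_space M01
  by (rule prob_space_M01)

lemma borel_measurable_M01I:
  "h \<in> borel_measurable borel \<Longrightarrow> h \<in> borel_measurable M01"
  unfolding M01_def by (intro measurable_restrict_space1) (simp add: measurable_completion)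

lemma borel_measurable_M01_iff:
  fixes h :: "real \<Rightarrow> real"
  shows "h \<in> borel_measurable M01 \<longleftrightarrow> (\<lambda>t. indicator {0..1} t * h t) \<in> borel_measurable lebesgue"
  unfolding M01_def by (subst borel_measurable_restrict_space_iff) auto

lemma borel_measurable_lebesgue_indicator_times:
  fixes h :: "real \<Rightarrow> real"
  assumes "h \<in> borel_measurable M01" "S \<in> sets borel" "S \<subseteq> {0..1}"
  shows "(\<lambda>t. indicator S t * h t) \<in> borel_measurable lebesgue"
proof -
  have "(\<lambda>t. indicator S t * (indicator {0..1} t * h t)) \<in> borel_measurable lebesgue"
    using assms(2)
    by (intro borel_measurable_times[OF _ assms(1)[unfolded borel_measurable_M01_iff]]
        borel_measurable_indicator) auto
  also have "(\<lambda>t. indicator S t * (indicator {0..1} t * h t)) = (\<lambda>t. indicator S t * h t)"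
    using assms(3) by (auto simp: indicator_def fun_eq_iff)
  finally show ?thesis .
qed

lemma borel_measurable_lebesgue_affine:
  fixes a b :: real
  assumes "h \<in> borel_measurable lebesgue" "b \<noteq> 0"
  shows "(\<lambda>t. h (a + b * t)) \<in> borel_measurable lebesgue"
proof -
  have "(\<lambda>t. a + b * t) \<in> lebesgue \<rightarrow>\<^sub>M lebesgue"
    using lebesgue_affine_measurable[of "\<lambda>_. b" a] assms(2) by simp
  then show ?thesis
    using assms(1) by (rule measurable_compose)
qed

lemma has_bochner_integral_M01_iff:
  fixes h :: "real \<Rightarrow> real"
  shows "has_bochner_integral M01 h I \<longleftrightarrow> has_bochner_integral lebesgue (\<lambda>t. indicator {0..1} t * h t) I"
  unfolding M01_def by (subst has_bochner_integral_restrict_space) auto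

lemma sets_M01_atLeastAtMost: "0 \<le> a \<Longrightarrow> b \<le> 1 \<Longrightarrow> {a..b} \<in> sets M01"
  unfolding M01_def by (auto simp: sets_restrict_space_iff)

lemma measure_M01_atLeastAtMost: "0 \<le> a \<Longrightarrow> a \<le> b \<Longrightarrow> b \<le> 1 \<Longrightarrow> measure M01 {a..b} = b - a"
  unfolding M01_def by (subst measure_restrict_space) auto

lemma sets_M01_right_end: "0 < M \<Longrightarrow> {1 - 1 / real M..1} \<in> sets M01"
  by (intro sets_M01_atLeastAtMost) auto

lemma AE_M01_not_in_countable:
  assumes "countable Z"
  shows "AE t in M01. t \<notin> Z"
proof -
  have "AE t in lebesgue. t \<notin> Z"
    using assms by (intro AE_completion AE_not_in countable_imp_null_set_lborel)
  then show ?thesis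
    unfolding M01_def by (subst AE_restrict_space_iff) auto
qed

lemma AE_M01_blockI:
  assumes "0 < K" and P: "\<And>i u. i < K \<Longrightarrow> 0 < u \<Longrightarrow> u < 1 \<Longrightarrow> P ((real i + u) / real K)"
  shows "AE t in M01. P t"
proof -
  have "countable ((\<lambda>k. k / real K) ` \<int> \<union> {0, 1})"
    by (auto simp: Ints_def)
  then have "AE t in M01. t \<notin> (\<lambda>k. k / real K) ` \<int> \<union> {0, 1}"
    by (rule AE_M01_not_in_countable)
  then show ?thesis
    using AE_space
  proof eventually_elim
    fix t assume t: "t \<notin> (\<lambda>k. k / real K) ` \<int> \<union> {0, 1}" "t \<in> space M01"
    define i where "i = nat \<lfloor>real K * t\<rfloor>"
    have t_bounds: "0 < t" "t < 1" using t by (auto simp: space_M01)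
    then have real_i: "real i = of_int \<lfloor>real K * t\<rfloor>"
      by (simp add: i_def)
    have "real K * t \<notin> \<int>"
      using t(1) \<open>0 < K\<close> image_eqI[of t "\<lambda>k. k / real K" "real K * t" \<int>] by auto
    then have "0 < frac (real K * t)" by simp
    moreover have "real i < real K"
      using t_bounds \<open>0 < K\<close> unfolding real_i by (intro le_less_trans[OF of_int_floor_le]) simp
    ultimately have "P ((real i + frac (real K * t)) / real K)"
      by (intro P) (simp_all add: frac_lt_1)
    then show "P t"
      using \<open>0 < K\<close> by (simp add: real_i frac_def)
  qed
qed

lemma AE_M01I: "(\<And>t. 0 < t \<Longrightarrow> t < 1 \<Longrightarrow> P t) \<Longrightarrow> AE t in M01. P t"
  using AE_M01_blockI[of 1 P] by simp

subsection \<open>Juxtaposition of compressed functions\<close>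

text \<open>At \<open>t = 1\<close> the index is \<open>K\<close>, one too large; facts about \<open>glue K h\<close> hold only almost everywhere.\<close>

definition glue :: "nat \<Rightarrow> (nat \<Rightarrow> real \<Rightarrow> real) \<Rightarrow> real \<Rightarrow> real" where
  "glue K h t = h (nat \<lfloor>real K * t\<rfloor>) (frac (real K * t))"

lemma block_point_less_1:
  assumes "i < K" "u < 1"
  shows "(real i + u) / real K < 1"
proof -
  have "real (Suc i) \<le> real K"
    using assms by (simp only: of_nat_le_iff Suc_le_eq)
  then show ?thesis
    using assms by simp
qed

lemma glue_block:
  assumes "0 < K" "0 \<le> u" "u < 1"
  shows "glue K h ((real i + u) / real K) = h i u"
proof -
  have "\<lfloor>real i + u\<rfloor> = int i"
    using assms by (intro floor_unique) auto
  then show ?thesis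
    using assms by (simp add: glue_def frac_def)
qed

lemma in_block_iff:
  assumes "i < K"
  shows "- real i + real K * t \<in> {0..<1} \<longleftrightarrow> t \<in> {0..<1} \<and> i = nat \<lfloor>real K * t\<rfloor>"
proof (intro iffI conjI)
  assume block: "- real i + real K * t \<in> {0..<1}"
  have "real (Suc i) \<le> real K"
    using assms by (simp only: of_nat_le_iff Suc_le_eq)
  then have "real K * t < real K * 1"
    using block unfolding atLeastLessThan_iff by linarith
  then have "t < 1"
    by (rule mult_left_less_imp_less) simp
  moreover have "0 \<le> real K * t"
    using block by simp
  ultimately show "t \<in> {0..<1}"
    using assms by (simp add: zero_le_mult_iff)
  have "\<lfloor>real K * t\<rfloor> = int i"
    using block by (intro floor_unique) auto
  then show "i = nat \<lfloor>real K * t\<rfloor>"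
    by simp
next
  assume "t \<in> {0..<1} \<and> i = nat \<lfloor>real K * t\<rfloor>"
  then have "real i = of_int \<lfloor>real K * t\<rfloor>"
    by simp
  then show "- real i + real K * t \<in> {0..<1}"
    by simp linarith
qed

lemma indicator_mult_glue:
  assumes "0 < K" "t \<noteq> 1"
  shows "indicator {0..1} t * glue K h t =
    (\<Sum>i<K. indicator {0..<1} (- real i + real K * t) * h i (- real i + real K * t))"
proof (cases "t \<in> {0..<1}")
  case True
  define i where "i = nat \<lfloor>real K * t\<rfloor>"
  have real_i: "real i = of_int \<lfloor>real K * t\<rfloor>"
    using True by (simp add: i_def)
  have "real i < real K"
    using True \<open>0 < K\<close> unfolding real_i by (intro le_less_trans[OF of_int_floor_le]) simp
  have "(\<Sum>j<K. indicator {0..<1} (- real j + real K * t) * h j (- real j + real K * t)) =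
      (\<Sum>j<K. if j = i then h i (- real i + real K * t) else 0)"
    using True in_block_iff[of _ K t] by (intro sum.cong) (auto simp: indicator_def i_def)
  then show ?thesis
    using True \<open>real i < real K\<close> real_i by (simp add: glue_def i_def[symmetric] frac_def)
next
  case False
  then have "(\<Sum>i<K. indicator {0..<1} (- real i + real K * t) * h i (- real i + real K * t)) = 0"
    using in_block_iff[of _ K t] by (intro sum.neutral) (auto simp: indicator_def)
  moreover have "indicator {0..1} t = (0 :: real)"
    using False \<open>t \<noteq> 1\<close> by (auto simp: indicator_def)
  ultimately show ?thesis by (simp only: mult_zero_left)
qed

lemma borel_measurable_glue:
  assumes h: "\<And>i. i < K \<Longrightarrow> h i \<in> borel_measurable M01" and "0 < K"
  shows "glue K h \<in> borel_measurable M01"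
  unfolding borel_measurable_M01_iff
proof (rule measurable_discrete_difference)
  show "(\<lambda>t. \<Sum>i<K. indicator {0..<1} (- real i + real K * t) * h i (- real i + real K * t))
      \<in> borel_measurable lebesgue"
    using assms
    by (intro borel_measurable_sum borel_measurable_lebesgue_indicator_times
        borel_measurable_lebesgue_affine[where h = "\<lambda>v. indicator {0..<1} v * h _ v"]) auto
  show "(\<Sum>i<K. indicator {0..<1} (- real i + real K * t) * h i (- real i + real K * t)) =
      indicator {0..1} t * glue K h t" if "t \<notin> {1}" for t
    using that by (intro indicator_mult_glue[symmetric] \<open>0 < K\<close>) simp
qed auto

lemma borel_measurable_block:
  fixes g :: "real \<Rightarrow> real"
  assumes "g \<in> borel_measurable M01" "i < K"
  shows "(\<lambda>u. g ((real i + u) / real K)) \<in> borel_measurable M01"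
proof -
  have "(\<lambda>u. indicator {0..1} (real i / real K + 1 / real K * u) * g (real i / real K + 1 / real K * u))
      \<in> borel_measurable lebesgue"
    using assms
    by (intro borel_measurable_lebesgue_affine[where h = "\<lambda>v. indicator {0..1} v * g v"])
      (auto simp: borel_measurable_M01_iff)
  then have "(\<lambda>u. indicator {0..1} (real i / real K + 1 / real K * u) * g (real i / real K + 1 / real K * u))
      \<in> borel_measurable M01"
    unfolding M01_def by (rule measurable_restrict_space1)
  moreover have "indicator {0..1} (real i / real K + 1 / real K * u) * g (real i / real K + 1 / real K * u) =
      g ((real i + u) / real K)" if "u \<in> space M01" for u
  proof -
    have "real (Suc i) \<le> real K"
      using assms(2) by (simp only: of_nat_le_iff Suc_le_eq)
    then show ?thesis
      using that by (auto simp: space_M01 indicator_def field_simps)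
  qed
  ultimately show ?thesis
    by (simp cong: measurable_cong)
qed

lemma AE_glue_blocks:
  assumes "0 < K"
  shows "AE t in M01. glue K (\<lambda>i u. g ((real i + u) / real K)) t = g t"
  using assms by (intro AE_M01_blockI[OF assms]) (simp add: glue_block)

lemma has_bochner_integral_glue:
  assumes h: "\<And>i. i < K \<Longrightarrow> has_bochner_integral M01 (h i) (I i)" and "0 < K"
  shows "has_bochner_integral M01 (glue K h) ((\<Sum>i<K. I i) / real K)"
proof -
  have piece: "has_bochner_integral lebesgue
      (\<lambda>t. indicator {0..<1} (- real i + real K * t) * h i (- real i + real K * t)) (I i / real K)"
    if "i < K" for i
  proof -
    have "has_bochner_integral lebesgue (\<lambda>v. indicator {0..1} v * h i v) (I i)"
      using h[OF that] by (simp add: has_bochner_integral_M01_iff)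
    then have "has_bochner_integral lebesgue (\<lambda>v. indicator {0..<1} v * h i v) (I i)"
      by (subst has_bochner_integral_discrete_difference[of "{1}" _ _ "\<lambda>v. indicator {0..1} v * h i v"])
        (auto simp: indicator_def)
    then show ?thesis
      using \<open>0 < K\<close>
      by (subst (asm) has_bochner_integral_lebesgue_real_affine_iff[of "real K" _ _ "- real i"])
        (simp_all add: divideR_right field_simps)
  qed
  have "has_bochner_integral lebesgue
      (\<lambda>t. \<Sum>i<K. indicator {0..<1} (- real i + real K * t) * h i (- real i + real K * t))
      (\<Sum>i<K. I i / real K)"
    by (intro has_bochner_integral_sum piece) simp
  then show ?thesis
    unfolding has_bochner_integral_M01_iff sum_divide_distrib
    using indicator_mult_glue[OF \<open>0 < K\<close>]
    by (subst has_bochner_integral_discrete_difference[of "{1}"]) auto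
qed

subsection \<open>Equimeasurable functions\<close>

definition distribution :: "(real \<Rightarrow> real) \<Rightarrow> real \<Rightarrow> real" where
  "distribution x s = measure M01 {t \<in> space M01. s < x t}"

lemma equimeasurable_iff_distribution_eq: "equimeasurable x y \<longleftrightarrow> distribution x = distribution y"
  by (simp add: equimeasurable_def distribution_def fun_eq_iff)

lemma has_bochner_integral_distribution:
  assumes [measurable]: "x \<in> borel_measurable M01"
  shows "has_bochner_integral M01 (\<lambda>t. indicator {s<..} (x t)) (distribution x s)"
proof -
  have "has_bochner_integral M01 (indicator {t \<in> space M01. s < x t}) (distribution x s)"
    unfolding distribution_def by (intro has_bochner_integral_real_indicator) (auto simp: less_top[symmetric])
  then show ?thesis
    by (rule has_bochner_integral_cong[THEN iffD1, rotated -1]) (auto simp: indicator_def)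
qed

lemma distribution_glue:
  assumes [measurable]: "\<And>i. i < K \<Longrightarrow> h i \<in> borel_measurable M01" and "0 < K"
  shows "distribution (glue K h) s = (\<Sum>i<K. distribution (h i) s) / real K"
proof (rule has_bochner_integral_eq)
  show "has_bochner_integral M01 (\<lambda>t. indicator {s<..} (glue K h t)) (distribution (glue K h) s)"
    using assms by (intro has_bochner_integral_distribution borel_measurable_glue)
  have "has_bochner_integral M01 (glue K (\<lambda>i u. indicator {s<..} (h i u)))
      ((\<Sum>i<K. distribution (h i) s) / real K)"
    using assms by (intro has_bochner_integral_glue has_bochner_integral_distribution)
  moreover have "glue K (\<lambda>i u. indicator {s<..} (h i u)) = (\<lambda>t. indicator {s<..} (glue K h t))"
    by (simp add: glue_def fun_eq_iff)
  ultimately show "has_bochner_integral M01 (\<lambda>t. indicator {s<..} (glue K h t))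
      ((\<Sum>i<K. distribution (h i) s) / real K)"
    by simp
qed

lemma equimeasurable_cong_AE:
  assumes [measurable]: "x \<in> borel_measurable M01" "y \<in> borel_measurable M01"
    and "AE t in M01. x t = y t"
  shows "equimeasurable x y"
  unfolding equimeasurable_def
  using assms(3) by (intro allI M01.finite_measure_eq_AE) (auto elim: eventually_mono)

lemma equimeasurable_glue_permute:
  assumes "\<And>i. i < K \<Longrightarrow> h i \<in> borel_measurable M01" "0 < K"
    and \<pi>: "bij_betw \<pi> {..<K} {..<K}"
  shows "equimeasurable (glue K (\<lambda>i. h (\<pi> i))) (glue K h)"
proof -
  have "(\<Sum>i<K. distribution (h (\<pi> i)) s) = (\<Sum>i<K. distribution (h i) s)" for s
    using \<pi> by (rule sum.reindex_bij_betw)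
  moreover have "h (\<pi> i) \<in> borel_measurable M01" if "i < K" for i
    using assms(1) \<pi> that by (auto simp: bij_betw_def)
  ultimately show ?thesis
    using assms by (simp add: equimeasurable_iff_distribution_eq fun_eq_iff distribution_glue)
qed

lemma cdf_distr_M01:
  assumes [measurable]: "x \<in> borel_measurable M01"
  shows "cdf (distr M01 borel x) s = 1 - distribution x s"
proof -
  have "cdf (distr M01 borel x) s = measure M01 (x -` {..s} \<inter> space M01)"
    by (simp add: cdf_def measure_distr)
  also have "x -` {..s} \<inter> space M01 = space M01 - {t \<in> space M01. s < x t}"
    by auto
  finally show ?thesis
    by (simp add: distribution_def M01.prob_compl)
qed

lemma distr_eq_if_equimeasurable:
  assumes "x \<in> borel_measurable M01" "y \<in> borel_measurable M01" "equimeasurable x y"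
  shows "distr M01 borel x = distr M01 borel y"
  using assms
  by (intro cdf_unique M01.real_distribution_distr)
    (auto simp: equimeasurable_iff_distribution_eq cdf_distr_M01)

lemma nn_integral_eq_if_equimeasurable:
  assumes [measurable]: "x \<in> borel_measurable M01" "y \<in> borel_measurable M01"
    and "equimeasurable x y"
  shows "(\<integral>\<^sup>+t. ennreal (x t) \<partial>M01) = (\<integral>\<^sup>+t. ennreal (y t) \<partial>M01)"
proof -
  have "(\<integral>\<^sup>+s. ennreal s \<partial>distr M01 borel x) = (\<integral>\<^sup>+s. ennreal s \<partial>distr M01 borel y)"
    using distr_eq_if_equimeasurable[OF assms] by simp
  then show ?thesis
    by (simp add: nn_integral_distr)
qed

lemma equimeasurable_indicator:
  assumes [measurable]: "A \<in> sets M01" "B \<in> sets M01" and "measure M01 A = measure M01 B"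
  shows "equimeasurable (indicator A) (indicator B)"
proof -
  have "distribution (indicator S) s = (if s < 0 then 1 else if s < 1 then measure M01 S else 0)"
    if S: "S \<in> sets M01" for S s
  proof -
    have "{t \<in> space M01. s < indicator S t} =
        (if s < 0 then space M01 else if s < 1 then S else {})"
      using sets.sets_into_space[OF S] by (auto simp: indicator_def)
    then show ?thesis
      by (simp add: distribution_def M01.prob_space)
  qed
  then show ?thesis
    using assms by (simp add: equimeasurable_iff_distribution_eq fun_eq_iff)
qed

lemma equimeasurable_if_quantile:
  assumes [measurable]: "x \<in> borel_measurable M01" "g \<in> borel_measurable M01"
    and less_iff: "\<And>s t. 0 < t \<Longrightarrow> t < 1 \<Longrightarrow> s < g t \<longleftrightarrow> 1 - distribution x s < t"
  shows "equimeasurable g x"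
  unfolding equimeasurable_iff_distribution_eq
proof
  fix s
  let ?p = "1 - distribution x s"
  have p_bounds: "0 \<le> ?p" "?p \<le> 1"
    by (simp_all add: distribution_def)
  have "AE t in M01. t \<notin> {0, 1, ?p}"
    by (rule AE_M01_not_in_countable) simp
  then have "AE t in M01. t \<in> {t \<in> space M01. s < g t} \<longleftrightarrow> t \<in> {?p..1}"
    using AE_space by eventually_elim (use p_bounds less_iff in \<open>force simp: space_M01\<close>)
  then have "distribution g s = measure M01 {?p..1}"
    unfolding distribution_def[of g] using p_bounds by (intro measure_eq_AE sets_M01_atLeastAtMost) auto
  also have "\<dots> = distribution x s"
    using p_bounds by (simp add: measure_M01_atLeastAtMost)
  finally show "distribution g s = distribution x s" .
qed

lemma increasing_rearrangement_exists:
  assumes x [measurable]: "x \<in> borel_measurable M01" and nonneg: "\<And>t. 0 \<le> x t"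
  obtains g where "g \<in> borel_measurable M01" "equimeasurable g x"
    "mono_on {0<..<1} g" "\<And>t. 0 \<le> g t"
proof -
  interpret D: cdf_distribution "distr M01 borel x"
    using M01.real_distribution_distr[of x] by (simp add: cdf_distribution_def)
  define g where "g t = indicator {0<..<1} t * D.I t" for t
  have less_g_iff: "s < g t \<longleftrightarrow> D.C s < t" if "0 < t" "t < 1" for s t
    using D.pseudoinverse[of t s] that by (simp add: g_def not_le[symmetric])
  have C_neg: "D.C s = 0" if "s < 0" for s
  proof -
    have "{t \<in> space M01. s < x t} = space M01"
      using nonneg that by (auto intro: less_le_trans)
    then show ?thesis
      by (simp add: cdf_distr_M01 distribution_def M01.prob_space)
  qed
  have g_nonneg: "0 \<le> g t" for t
  proof (cases "t \<in> {0<..<1}")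
    case True
    then show ?thesis
      using less_g_iff[of t "g t"] C_neg[of "g t"] by (auto simp: not_less[symmetric])
  qed (simp add: g_def)
  have g_mono: "mono_on {0<..<1} g"
    using D.mono_I by (simp add: g_def mono_on_def)
  have "g \<in> borel_measurable borel"
    using D.measurable_CI unfolding g_def
    by (subst (asm) borel_measurable_restrict_space_iff) auto
  then have g_meas [measurable]: "g \<in> borel_measurable M01"
    by (rule borel_measurable_M01I)
  have "equimeasurable g x"
    using x g_meas less_g_iff by (intro equimeasurable_if_quantile) (simp_all add: cdf_distr_M01)
  with g_meas show ?thesis
    using g_mono g_nonneg by (rule that)
qed

subsection \<open>Level sums and dilations as juxtapositions\<close>

lemma level_sum_Suc:
  "level_sum \<xi> f (Suc k) t =
     V0 (level_sum (\<lambda>\<alpha>. \<xi> (False # \<alpha>)) f k) t + V1 (level_sum (\<lambda>\<alpha>. \<xi> (True # \<alpha>)) f k) t"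
proof -
  let ?A = "{\<alpha>::bool list. length \<alpha> = k}"
  have "finite ?A"
    using finite_lists_length_eq[of "UNIV::bool set" k] by simp
  moreover have "{\<alpha>::bool list. length \<alpha> = Suc k} = Cons False ` ?A \<union> Cons True ` ?A"
    by (auto simp: length_Suc_conv image_iff)
  ultimately have "level_sum \<xi> f (Suc k) t =
     (\<Sum>\<alpha>\<in>?A. \<xi> (False # \<alpha>) * V0 (Valpha \<alpha> f) t) + (\<Sum>\<alpha>\<in>?A. \<xi> (True # \<alpha>) * V1 (Valpha \<alpha> f) t)"
    unfolding level_sum_def
    by (simp only:) (subst sum.union_disjoint; auto simp: sum.reindex inj_on_def)
  then show ?thesis
    by (auto simp: V0_def V1_def level_sum_def sum_distrib_left)
qed

lemma level_sum_Suc_left_block: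
  assumes "i < 2 ^ k" "0 < u" "u < 1"
  shows "level_sum \<xi> f (Suc k) ((real i + u) / 2 ^ Suc k) =
    level_sum (\<lambda>\<alpha>. \<xi> (False # \<alpha>)) f k ((real i + u) / 2 ^ k)"
proof -
  have "(real i + u) / 2 ^ k < 1"
    using block_point_less_1[OF assms(1,3)] by simp
  moreover have "2 * ((real i + u) / 2 ^ Suc k) = (real i + u) / 2 ^ k"
    by (simp add: field_simps)
  ultimately show ?thesis
    using assms unfolding level_sum_Suc V0_def V1_def by simp
qed

lemma level_sum_Suc_right_block:
  assumes "i < 2 ^ k" "0 < u" "u < 1"
  shows "level_sum \<xi> f (Suc k) ((real (2 ^ k + i) + u) / 2 ^ Suc k) =
    level_sum (\<lambda>\<alpha>. \<xi> (True # \<alpha>)) f k ((real i + u) / 2 ^ k)"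
proof -
  have "(real i + u) / 2 ^ k < 1"
    using block_point_less_1[OF assms(1,3)] by simp
  moreover have "0 < (real i + u) / 2 ^ k"
    using assms by simp
  moreover have "2 * ((real (2 ^ k + i) + u) / 2 ^ Suc k) - 1 = (real i + u) / 2 ^ k"
    by (simp add: field_simps)
  ultimately show ?thesis
    using assms unfolding level_sum_Suc V0_def V1_def by simp
qed

lemma level_sum_block:
  "\<exists>c. \<forall>i<2 ^ k. \<forall>u\<in>{0<..<1}. level_sum \<xi> f k ((real i + u) / 2 ^ k) = c i * f u"
proof (induction k arbitrary: \<xi>)
  case 0
  show ?case
    by (rule exI[of _ "\<lambda>_. \<xi> []"]) (simp add: level_sum_def)
next
  case (Suc k)
  obtain c\<^sub>0 c\<^sub>1 where
    c\<^sub>0: "\<And>i u. i < 2 ^ k \<Longrightarrow> u \<in> {0<..<1} \<Longrightarrow>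
      level_sum (\<lambda>\<alpha>. \<xi> (False # \<alpha>)) f k ((real i + u) / 2 ^ k) = c\<^sub>0 i * f u" and
    c\<^sub>1: "\<And>i u. i < 2 ^ k \<Longrightarrow> u \<in> {0<..<1} \<Longrightarrow>
      level_sum (\<lambda>\<alpha>. \<xi> (True # \<alpha>)) f k ((real i + u) / 2 ^ k) = c\<^sub>1 i * f u"
    using Suc.IH by metis
  define c where "c i = (if i < 2 ^ k then c\<^sub>0 i else c\<^sub>1 (i - 2 ^ k))" for i :: nat
  have "level_sum \<xi> f (Suc k) ((real i + u) / 2 ^ Suc k) = c i * f u"
    if i: "i < 2 ^ Suc k" and u: "u \<in> {0<..<1}" for i u
  proof (cases "i < 2 ^ k")
    case True
    then show ?thesis
      using u c\<^sub>0 level_sum_Suc_left_block[of i k u] by (simp add: c_def)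
  next
    case False
    define j where "j = i - 2 ^ k"
    have j: "i = 2 ^ k + j" "j < 2 ^ k"
      using i False by (auto simp: j_def)
    then show ?thesis
      using u c\<^sub>1 level_sum_Suc_right_block[of j k u] by (simp add: c_def)
  qed
  then show ?case by blast
qed

lemma level_sum_eq_glue:
  obtains c where "AE t in M01. level_sum \<xi> f k t = glue (2 ^ k) (\<lambda>i u. c i * f u) t"
proof -
  obtain c where c: "\<forall>i<2 ^ k. \<forall>u\<in>{0<..<1}. level_sum \<xi> f k ((real i + u) / 2 ^ k) = c i * f u"
    using level_sum_block by blast
  have "AE t in M01. level_sum \<xi> f k t = glue (2 ^ k) (\<lambda>i u. c i * f u) t"
  proof (rule AE_M01_blockI[of "2 ^ k"])
    fix i :: nat and u :: real
    assume "i < 2 ^ k" "0 < u" "u < 1"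
    then show "level_sum \<xi> f k ((real i + u) / real (2 ^ k)) =
        glue (2 ^ k) (\<lambda>i u. c i * f u) ((real i + u) / real (2 ^ k))"
      using c by (simp add: glue_block del: of_nat_power) simp
  qed simp
  then show ?thesis
    by (rule that)
qed

lemma dil_eq_glue:
  assumes "0 < M"
  shows "AE t in M01. dil (1 / real M) x t = glue M (\<lambda>i u. if i = 0 then x u else 0) t"
proof (rule AE_M01_blockI[OF assms])
  fix i u assume u: "0 < u" "u < (1::real)"
  have "dil (1 / real M) x ((real i + u) / real M) = (if i = 0 then x u else 0)"
  proof (cases "i = 0")
    case True
    then show ?thesis
      using assms u by (auto simp: dil_def field_simps)
  next
    case False
    then have "1 / real M \<le> (real i + u) / real M"
      using u by (intro divide_right_mono) auto
    then show ?thesis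
      using False by (simp add: dil_def)
  qed
  also have "\<dots> = glue M (\<lambda>i u. if i = 0 then x u else 0) ((real i + u) / real M)"
    using assms u by (simp add: glue_block)
  finally show "dil (1 / real M) x ((real i + u) / real M) =
      glue M (\<lambda>i u. if i = 0 then x u else 0) ((real i + u) / real M)" .
qed

lemma borel_measurable_dil:
  assumes "x \<in> borel_measurable M01" "0 < \<tau>" "\<tau> \<le> 1"
  shows "dil \<tau> x \<in> borel_measurable M01"
proof -
  have "(\<lambda>t. indicator {0<..<1} (0 + 1 / \<tau> * t) * x (0 + 1 / \<tau> * t)) \<in> borel_measurable lebesgue"
    using assms
    by (intro borel_measurable_lebesgue_affine[where h = "\<lambda>v. indicator {0<..<1} v * x v"]
        borel_measurable_lebesgue_indicator_times) auto
  also have "(\<lambda>t. indicator {0<..<1} (0 + 1 / \<tau> * t) * x (0 + 1 / \<tau> * t)) = dil \<tau> x"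
    using assms by (auto simp: dil_def indicator_def fun_eq_iff zero_less_divide_iff)
  finally show ?thesis
    unfolding M01_def by (rule measurable_restrict_space1)
qed

lemma equimeasurable_dil:
  assumes x: "x \<in> borel_measurable M01" and "0 < M" "0 < P"
  shows "equimeasurable (dil (1 / real M) x) (glue (M * P) (\<lambda>i u. if i < P then x u else 0))"
proof -
  have distribution_blocks: "distribution (glue (M * Q) (\<lambda>i u. if i < Q then x u else 0)) s =
      (distribution x s + (real M - 1) * distribution (\<lambda>_. 0) s) / real M" if "0 < Q" for Q s
  proof -
    have "distribution (\<lambda>u. if i < Q then x u else 0) s =
        (if i < Q then distribution x s else distribution (\<lambda>_. 0) s)" for i
      by simp
    then have "distribution (glue (M * Q) (\<lambda>i u. if i < Q then x u else 0)) s =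
        (\<Sum>i<M * Q. if i < Q then distribution x s else distribution (\<lambda>_. 0) s) / real (M * Q)"
      using that x \<open>0 < M\<close> by (subst distribution_glue) auto
    also have "(\<Sum>i<M * Q. if i < Q then distribution x s else distribution (\<lambda>_. 0) s) =
        real Q * (distribution x s + (real M - 1) * distribution (\<lambda>_. 0) s)"
    proof -
      have "{..<M * Q} \<inter> {i. i < Q} = {..<Q}" "{..<M * Q} \<inter> - {i. i < Q} = {Q..<M * Q}" "Q \<le> M * Q"
        using \<open>0 < M\<close> by (auto intro: less_le_trans)
      then show ?thesis
        by (simp add: sum.If_cases of_nat_diff algebra_simps)
    qed
    finally show ?thesis
      using that by simp
  qed
  have "(\<lambda>u. if i = 0 then x u else 0) \<in> borel_measurable M01" for i :: nat
    using x by (cases "i = 0") auto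
  then have "equimeasurable (dil (1 / real M) x) (glue M (\<lambda>i u. if i = 0 then x u else 0))"
    using assms
    by (intro equimeasurable_cong_AE dil_eq_glue borel_measurable_dil borel_measurable_glue) auto
  then show ?thesis
    using distribution_blocks[of 1] distribution_blocks[OF \<open>0 < P\<close>]
    by (simp add: equimeasurable_iff_distribution_eq fun_eq_iff)
qed

lemma bij_betw_add_mod: "bij_betw (\<lambda>i. (i + j) mod P) {..<P} {..<P::nat}"
proof -
  have "inj_on (\<lambda>i. (i + j) mod P) {..<P}"
  proof (rule inj_onI)
    fix a b assume "a \<in> {..<P}" "b \<in> {..<P}" "(a + j) mod P = (b + j) mod P"
    then show "a = b"
      by (simp add: cong_def[symmetric] cong_add_rcancel_nat cong_less_modulus_unique_nat)
  qed
  then show ?thesis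
    by (intro bij_betw_imageI endo_inj_surj) auto
qed

subsection \<open>Symmetric spaces\<close>

locale symm_space =
  fixes X :: "(real \<Rightarrow> real) set" and N :: "(real \<Rightarrow> real) \<Rightarrow> real"
  assumes mem_measurable: "x \<in> X \<Longrightarrow> x \<in> borel_measurable M01"
    and add_mem: "x \<in> X \<Longrightarrow> y \<in> X \<Longrightarrow> (\<lambda>t. x t + y t) \<in> X"
    and cmult_mem: "x \<in> X \<Longrightarrow> (\<lambda>t. a * x t) \<in> X"
    and N_nonneg: "x \<in> X \<Longrightarrow> 0 \<le> N x"
    and N_eq_0_iff: "x \<in> X \<Longrightarrow> N x = 0 \<longleftrightarrow> (AE t in M01. x t = 0)"
    and N_triangle: "x \<in> X \<Longrightarrow> y \<in> X \<Longrightarrow> N (\<lambda>t. x t + y t) \<le> N x + N y"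
    and N_cmult: "x \<in> X \<Longrightarrow> N (\<lambda>t. a * x t) = \<bar>a\<bar> * N x"
    and dominated_mem: "y \<in> X \<Longrightarrow> x \<in> borel_measurable M01 \<Longrightarrow>
      (AE t in M01. \<bar>x t\<bar> \<le> \<bar>y t\<bar>) \<Longrightarrow> x \<in> X"
    and N_mono: "y \<in> X \<Longrightarrow> x \<in> borel_measurable M01 \<Longrightarrow>
      (AE t in M01. \<bar>x t\<bar> \<le> \<bar>y t\<bar>) \<Longrightarrow> N x \<le> N y"
    and equimeasurable_mem: "y \<in> X \<Longrightarrow> x \<in> borel_measurable M01 \<Longrightarrow>
      equimeasurable x y \<Longrightarrow> x \<in> X"
    and N_equimeasurable: "y \<in> X \<Longrightarrow> x \<in> borel_measurable M01 \<Longrightarrow>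
      equimeasurable x y \<Longrightarrow> N x = N y"
    and N_one: "N (indicator {0..1}) = 1"

lemma symm_space_if_symmetric_space:
  assumes "symmetric_space X N"
  shows "symm_space X N"
proof
  note ax = assms[unfolded symmetric_space_def]
  show "x \<in> borel_measurable M01" if "x \<in> X" for x
    using ax that by (elim conjE) (rule subsetD)
  show "(\<lambda>t. x t + y t) \<in> X" if "x \<in> X" "y \<in> X" for x y
    using ax that by (elim conjE) (drule (1) bspec, drule (1) bspec, assumption)
  show "(\<lambda>t. a * x t) \<in> X" if "x \<in> X" for x a
    using ax that by (elim conjE) (drule (1) bspec, erule spec)
  show "0 \<le> N x" if "x \<in> X" for x
    using ax that by (elim conjE) (drule (1) bspec, assumption)
  show "N x = 0 \<longleftrightarrow> (AE t in M01. x t = 0)" if "x \<in> X" for x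
    using ax that by (elim conjE) (drule (1) bspec, assumption)
  show "N (\<lambda>t. x t + y t) \<le> N x + N y" if "x \<in> X" "y \<in> X" for x y
    using ax that by (elim conjE) (drule (1) bspec, drule (1) bspec, assumption)
  show "N (\<lambda>t. a * x t) = \<bar>a\<bar> * N x" if "x \<in> X" for x a
    using ax that by (elim conjE) (drule (1) bspec, erule spec)
  show "x \<in> X" and "N x \<le> N y"
    if "y \<in> X" "x \<in> borel_measurable M01" "AE t in M01. \<bar>x t\<bar> \<le> \<bar>y t\<bar>" for x y
  proof -
    have "x \<in> X \<and> N x \<le> N y"
      using ax by (elim conjE) (drule spec[of _ x], drule spec[of _ y], erule mp, intro conjI that)
    then show "x \<in> X" "N x \<le> N y" by simp_all
  qed
  show "x \<in> X" and "N x = N y"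
    if "y \<in> X" "x \<in> borel_measurable M01" "equimeasurable x y" for x y
  proof -
    have "x \<in> X \<and> N x = N y"
      using ax by (elim conjE) (drule spec[of _ x], drule spec[of _ y], erule mp, intro conjI that)
    then show "x \<in> X" "N x = N y" by simp_all
  qed
  show "N (indicator {0..1}) = 1"
    using ax by (elim conjE)
qed

context symm_space
begin

lemma
  assumes y: "y \<in> X" and x: "x \<in> borel_measurable M01" and eq: "AE t in M01. \<bar>x t\<bar> = \<bar>y t\<bar>"
  shows cong_abs_mem: "x \<in> X" and N_cong_abs: "N x = N y"
proof -
  have le: "AE t in M01. \<bar>x t\<bar> \<le> \<bar>y t\<bar>" and ge: "AE t in M01. \<bar>y t\<bar> \<le> \<bar>x t\<bar>"
    using eq by (auto elim: eventually_mono)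
  show "x \<in> X"
    using y x le by (rule dominated_mem)
  then show "N x = N y"
    using N_mono[OF y x le] N_mono[OF _ mem_measurable[OF y] ge] by simp
qed

lemma
  assumes "finite J" "J \<noteq> {}" "\<And>j. j \<in> J \<Longrightarrow> u j \<in> X"
  shows sum_mem: "(\<lambda>t. \<Sum>j\<in>J. u j t) \<in> X"
    and N_sum_le: "N (\<lambda>t. \<Sum>j\<in>J. u j t) \<le> (\<Sum>j\<in>J. N (u j))"
proof -
  have "(\<lambda>t. \<Sum>j\<in>J. u j t) \<in> X \<and> N (\<lambda>t. \<Sum>j\<in>J. u j t) \<le> (\<Sum>j\<in>J. N (u j))"
    using assms
  proof (induction J rule: finite_ne_induct)
    case (insert j J)
    have u_mem: "u j \<in> X"
      and IH: "(\<lambda>t. \<Sum>j\<in>J. u j t) \<in> X" "N (\<lambda>t. \<Sum>j\<in>J. u j t) \<le> (\<Sum>j\<in>J. N (u j))"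
      using insert by auto
    show ?case
      using add_mem[OF u_mem IH(1)] N_triangle[OF u_mem IH(1)] IH(2) insert.hyps by simp
  qed auto
  then show "(\<lambda>t. \<Sum>j\<in>J. u j t) \<in> X" "N (\<lambda>t. \<Sum>j\<in>J. u j t) \<le> (\<Sum>j\<in>J. N (u j))"
    by auto
qed

lemma
  assumes h: "\<And>i. i < K \<Longrightarrow> h i \<in> borel_measurable M01" and mem: "glue K h \<in> X" and "0 < K"
    and \<pi>: "bij_betw \<pi> {..<K} {..<K}"
  shows glue_permute_mem: "glue K (\<lambda>i. h (\<pi> i)) \<in> X"
    and N_glue_permute: "N (glue K (\<lambda>i. h (\<pi> i))) = N (glue K h)"
proof -
  have "h (\<pi> i) \<in> borel_measurable M01" if "i < K" for i
    using h \<pi> that by (auto simp: bij_betw_def)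
  then have meas: "glue K (\<lambda>i. h (\<pi> i)) \<in> borel_measurable M01"
    using \<open>0 < K\<close> by (rule borel_measurable_glue)
  have eq: "equimeasurable (glue K (\<lambda>i. h (\<pi> i))) (glue K h)"
    using h \<open>0 < K\<close> \<pi> by (rule equimeasurable_glue_permute)
  show "glue K (\<lambda>i. h (\<pi> i)) \<in> X"
    using mem meas eq by (rule equimeasurable_mem)
  show "N (glue K (\<lambda>i. h (\<pi> i))) = N (glue K h)"
    using mem meas eq by (rule N_equimeasurable)
qed

lemma
  assumes h: "\<And>i. i < K \<Longrightarrow> h i \<in> borel_measurable M01" and mem: "glue K h \<in> X" and "0 < K"
    and J: "finite J" "J \<noteq> {}" and \<pi>: "\<And>j. j \<in> J \<Longrightarrow> bij_betw (\<pi> j) {..<K} {..<K}"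
  shows glue_sum_permuted_mem: "glue K (\<lambda>i u. \<Sum>j\<in>J. h (\<pi> j i) u) \<in> X"
    and N_glue_sum_permuted_le: "N (glue K (\<lambda>i u. \<Sum>j\<in>J. h (\<pi> j i) u)) \<le> real (card J) * N (glue K h)"
  using sum_mem[OF J, of "\<lambda>j. glue K (\<lambda>i. h (\<pi> j i))"]
    N_sum_le[OF J, of "\<lambda>j. glue K (\<lambda>i. h (\<pi> j i))"]
    glue_permute_mem[OF h mem \<open>0 < K\<close> \<pi>] N_glue_permute[OF h mem \<open>0 < K\<close> \<pi>]
  by (simp_all add: glue_def[abs_def])

lemma
  assumes h: "\<And>i. i < K \<Longrightarrow> h i \<in> borel_measurable M01" and mem: "glue K h \<in> X"
    and P: "0 < P" "P \<le> K"
  shows glue_block_sum_mem: "glue K (\<lambda>i u. if i < P then \<Sum>j<P. h j u else 0) \<in> X" (is "?S \<in> X")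
    and N_glue_block_sum_le:
      "N (glue K (\<lambda>i u. if i < P then \<Sum>j<P. h j u else 0)) \<le> real P * N (glue K h)"
proof -
  define \<pi> where "\<pi> j i = (if i < P then (i + j) mod P else i)" for j i
  have "bij_betw (\<pi> j) ({..<P} \<union> {P..<K}) ({..<P} \<union> {P..<K})" for j
  proof (rule bij_betw_combine)
    show "bij_betw (\<pi> j) {..<P} {..<P}"
      using bij_betw_add_mod[of j P] by (rule bij_betw_cong[THEN iffD1, rotated]) (simp add: \<pi>_def)
    show "bij_betw (\<pi> j) {P..<K} {P..<K}"
      using bij_betw_id by (rule bij_betw_cong[THEN iffD1, rotated]) (simp add: \<pi>_def)
  qed auto
  moreover have "{..<P} \<union> {P..<K} = {..<K}"
    using P by auto
  ultimately have \<pi>: "bij_betw (\<pi> j) {..<K} {..<K}" for j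
    by simp
  have "0 < K" "{..<P} \<noteq> {}" using P by auto
  let ?T = "glue K (\<lambda>i u. \<Sum>j<P. h (\<pi> j i) u)"
  have T_mem_le: "?T \<in> X" "N ?T \<le> real P * N (glue K h)"
    using glue_sum_permuted_mem[OF h mem \<open>0 < K\<close> _ \<open>{..<P} \<noteq> {}\<close> \<pi>]
      N_glue_sum_permuted_le[OF h mem \<open>0 < K\<close> _ \<open>{..<P} \<noteq> {}\<close> \<pi>] by simp_all
  have "(\<Sum>j<P. h (\<pi> j i) u) = (\<Sum>j<P. h j u)" if "i < P" for i u
    using sum.reindex_bij_betw[OF bij_betw_add_mod[of i P], of "\<lambda>j. h j u"] that
    by (simp add: \<pi>_def add.commute)
  then have "AE t in M01. \<bar>?S t\<bar> \<le> \<bar>?T t\<bar>"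
    by (simp add: glue_def)
  moreover have "(\<lambda>u. if i < P then \<Sum>j<P. h j u else 0) \<in> borel_measurable M01" for i
    using h P by (cases "i < P") auto
  then have "?S \<in> borel_measurable M01"
    using \<open>0 < K\<close> by (rule borel_measurable_glue)
  ultimately show "?S \<in> X" "N ?S \<le> real P * N (glue K h)"
    using dominated_mem[OF T_mem_le(1), of ?S] N_mono[OF T_mem_le(1), of ?S] T_mem_le(2) by auto
qed

lemma superlevel_indicator_mem:
  assumes x: "x \<in> X" and nz: "\<not> (AE t in M01. x t = 0)"
  obtains A where "A \<in> sets M01" "0 < measure M01 A" "indicator A \<in> X"
proof -
  have [measurable]: "x \<in> borel_measurable M01"
    using x by (rule mem_measurable)
  obtain n :: nat where n: "\<not> (AE t in M01. \<bar>x t\<bar> < 1 / real (Suc n))"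
  proof (rule ccontr)
    assume "\<not> thesis"
    then have "AE t in M01. \<forall>n. \<bar>x t\<bar> < 1 / real (Suc n)"
      using that unfolding AE_all_countable by blast
    then have "AE t in M01. x t = 0"
      by eventually_elim (metis nat_approx_posE not_less_iff_gr_or_eq zero_less_abs_iff)
    with nz show False by blast
  qed
  define A where "A = {t \<in> space M01. 1 / real (Suc n) \<le> \<bar>x t\<bar>}"
  have sets_A [measurable]: "A \<in> sets M01"
    unfolding A_def by measurable
  have "measure M01 A \<noteq> 0"
    using n AE_iff_measurable[OF sets_A, of "\<lambda>t. \<bar>x t\<bar> < 1 / real (Suc n)"]
    by (auto simp: A_def not_less M01.emeasure_eq_measure)
  then have "0 < measure M01 A"
    by (simp add: zero_less_measure_iff)
  moreover have "indicator A \<in> X"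
  proof (rule dominated_mem[OF cmult_mem[OF x]])
    show "AE t in M01. \<bar>indicator A t :: real\<bar> \<le> \<bar>real (Suc n) * x t\<bar>"
      by (rule AE_I2) (auto simp: A_def indicator_def abs_mult field_simps)
  qed measurable
  ultimately show ?thesis
    using sets_A by (intro that)
qed

lemma one_mem_if_indicator_mem:
  assumes A: "A \<in> sets M01" "0 < measure M01 A" "indicator A \<in> X"
  shows "indicator {0..1} \<in> X"
proof -
  define B where "B = {0..measure M01 A}"
  have B_meas: "B \<in> sets M01" "measure M01 B = measure M01 A"
    unfolding B_def by (auto intro!: sets_M01_atLeastAtMost simp: measure_M01_atLeastAtMost)
  have B_mem: "indicator B \<in> X"
    using A(3) by (rule equimeasurable_mem) (use A B_meas in \<open>auto intro: equimeasurable_indicator\<close>)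
  obtain m where m: "1 / real (Suc m) < measure M01 A"
    using nat_approx_posE[OF A(2)] by blast
  define h :: "nat \<Rightarrow> real \<Rightarrow> real" where "h i u = (if i = 0 then 1 else 0)" for i u
  have h_meas: "h i \<in> borel_measurable M01" for i
    unfolding h_def by simp
  have "glue (Suc m) h \<in> X"
    using B_mem
  proof (rule dominated_mem)
    show "AE t in M01. \<bar>glue (Suc m) h t\<bar> \<le> \<bar>indicator B t\<bar>"
    proof (rule AE_M01_blockI[of "Suc m"])
      fix i u assume u: "0 < u" "u < (1::real)"
      have "u / real (Suc m) \<in> B"
        using u m by (auto simp: B_def intro: order_trans[OF divide_right_mono[of u 1]])
      then show "\<bar>glue (Suc m) h ((real i + u) / real (Suc m))\<bar> \<le> \<bar>indicator B ((real i + u) / real (Suc m))\<bar>"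
        using u by (simp add: glue_block h_def del: of_nat_Suc)
    qed simp
  qed (use h_meas in \<open>auto intro: borel_measurable_glue\<close>)
  then have "glue (Suc m) (\<lambda>i u. if i < Suc m then \<Sum>j<Suc m. h j u else 0) \<in> X"
    using h_meas by (intro glue_block_sum_mem) auto
  then show ?thesis
  proof (rule dominated_mem)
    show "AE t in M01. \<bar>indicator {0..1} t :: real\<bar> \<le>
        \<bar>glue (Suc m) (\<lambda>i u. if i < Suc m then \<Sum>j<Suc m. h j u else 0) t\<bar>"
      by (rule AE_M01_blockI[of "Suc m"]) (simp_all add: glue_block h_def indicator_def del: of_nat_Suc)
  qed (simp add: borel_measurable_M01I)
qed

lemma one_mem_if_nonzero:
  assumes "x \<in> X" "\<not> (AE t in M01. x t = 0)"
  shows "indicator {0..1} \<in> X"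
  using assms by (rule superlevel_indicator_mem) (rule one_mem_if_indicator_mem)

end

subsection \<open>Domination of the \<open>L\<^sub>1\<close>-norm\<close>

lemma AE_truncated_eq_glue:
  "AE t in M01. indicator {..<1 - 1 / real (Suc m)} t * g t =
    glue (Suc m) (\<lambda>i u. if i < m then g ((real i + u) / real (Suc m)) else 0) t"
proof (rule AE_M01_blockI[of "Suc m"])
  fix i u assume u: "0 < u" "u < (1::real)"
  have "1 - 1 / real (Suc m) = real m / real (Suc m)"
    by (simp add: field_simps)
  then have "(real i + u) / real (Suc m) < 1 - 1 / real (Suc m) \<longleftrightarrow> real i + u < real m"
    by (simp add: divide_less_cancel)
  also have "\<dots> \<longleftrightarrow> i < m"
    using u by linarith
  finally show "indicator {..<1 - 1 / real (Suc m)} ((real i + u) / real (Suc m)) * g ((real i + u) / real (Suc m)) =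
      glue (Suc m) (\<lambda>i u. if i < m then g ((real i + u) / real (Suc m)) else 0) ((real i + u) / real (Suc m))"
    using u by (simp add: glue_block del: of_nat_Suc)
qed simp

lemma
  fixes A :: "nat \<Rightarrow> real set"
  defines "A \<equiv> \<lambda>m. {..<1 - 1 / real (Suc m)}"
  shows incseq_lessThan_one_minus_inverse: "incseq A"
    and UN_lessThan_one_minus_inverse: "(\<Union>m. A m) = {..<1}"
proof -
  show "incseq A"
  proof (rule incseq_SucI)
    fix m
    have "1 / real (Suc (Suc m)) \<le> 1 / real (Suc m)"
      by (simp add: frac_le)
    then show "A m \<subseteq> A (Suc m)"
      by (auto simp: A_def simp del: of_nat_Suc)
  qed
  have "\<exists>m. t < 1 - 1 / real (Suc m)" if "t < 1" for t
    using nat_approx_posE[of "1 - t"] that by (metis diff_gt_0_iff_gt less_diff_eq add.commute)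
  moreover have "t < 1" if "t < 1 - 1 / real (Suc m)" for t m
    using that by (rule less_le_trans) simp
  ultimately show "(\<Union>m. A m) = {..<1}"
    by (auto simp: A_def simp del: of_nat_Suc)
qed

lemma nn_integral_truncated_tendsto:
  assumes g: "g \<in> borel_measurable M01" and nonneg: "\<And>t. 0 \<le> g t"
  shows "(\<lambda>m. \<integral>\<^sup>+t. ennreal (indicator {..<1 - 1 / real (Suc m)} t * g t) \<partial>M01)
    \<longlonglongrightarrow> (\<integral>\<^sup>+t. ennreal (g t) \<partial>M01)"
proof -
  define A where "A m = {..<1 - 1 / real (Suc m)}" for m
  have inc: "incseq A" and UN: "(\<Union>m. A m) = {..<1}"
    unfolding A_def[abs_def]
    by (rule incseq_lessThan_one_minus_inverse UN_lessThan_one_minus_inverse)+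
  have "(\<lambda>m. \<integral>\<^sup>+t. ennreal (indicator (A m) t * g t) \<partial>M01) \<longlonglongrightarrow>
      (\<integral>\<^sup>+t. ennreal (indicator {..<1} t * g t) \<partial>M01)"
  proof (rule nn_integral_LIMSEQ)
    show "incseq (\<lambda>m t. ennreal (indicator (A m) t * g t))"
      using inc nonneg
      by (auto simp: incseq_def le_fun_def intro!: ennreal_leI mult_right_mono indicator_leI)
    show "(\<lambda>m. ennreal (indicator (A m) t * g t)) \<longlonglongrightarrow> ennreal (indicator {..<1} t * g t)" for t
      using LIMSEQ_indicator_incseq[OF inc, of t] unfolding UN
      by (intro tendsto_ennrealI tendsto_mult tendsto_const)
    show "(\<lambda>t. ennreal (indicator (A m) t * g t)) \<in> borel_measurable M01" for m
      by (intro measurable_compose[OF _ measurable_ennreal] borel_measurable_times g borel_measurable_M01I)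
        (simp add: A_def)
  qed
  also have "(\<integral>\<^sup>+t. ennreal (indicator {..<1} t * g t) \<partial>M01) = (\<integral>\<^sup>+t. ennreal (g t) \<partial>M01)"
    by (intro nn_integral_cong_AE AE_M01I) auto
  finally show ?thesis
    by (simp only: A_def)
qed

text \<open>A symmetric space in the sense of the definition may consist of the null functions alone: only
  the norm of the constant 1 is fixed, not its membership.\<close>

locale nontrivial_symm_space = symm_space +
  assumes one_mem: "indicator {0..1} \<in> X"
begin

lemma const_le_N:
  assumes y: "y \<in> X" and "0 \<le> a" and ae: "AE t in M01. a \<le> \<bar>y t\<bar>"
  shows "a \<le> N y"
proof -
  have "N (\<lambda>t. a * indicator {0..1} t) \<le> N y"
  proof (rule N_mono[OF y mem_measurable[OF cmult_mem[OF one_mem]]])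
    show "AE t in M01. \<bar>a * indicator {0..1} t\<bar> \<le> \<bar>y t\<bar>"
      using ae by eventually_elim (use \<open>0 \<le> a\<close> in \<open>auto simp: indicator_def\<close>)
  qed
  then show ?thesis
    using N_cmult[OF one_mem, of a] N_one \<open>0 \<le> a\<close> by simp
qed

lemma
  assumes g: "g \<in> X" and "0 < K"
  shows glue_translates_sum_mem:
      "glue K (\<lambda>i u. if i < K then \<Sum>j<K. g ((real j + u) / real K) else 0) \<in> X"
    and N_glue_translates_sum_le:
      "N (glue K (\<lambda>i u. if i < K then \<Sum>j<K. g ((real j + u) / real K) else 0)) \<le> real K * N g"
proof -
  define h where "h i u = g ((real i + u) / real K)" for i :: nat and u
  have h_meas: "h i \<in> borel_measurable M01" if "i < K" for i
    unfolding h_def using mem_measurable[OF g] that by (rule borel_measurable_block)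
  have "AE t in M01. \<bar>glue K h t\<bar> = \<bar>g t\<bar>"
    using AE_glue_blocks[OF \<open>0 < K\<close>, of g] unfolding h_def by eventually_elim simp
  then have glue_h: "glue K h \<in> X" "N (glue K h) = N g"
    using cong_abs_mem[OF g] N_cong_abs[OF g] borel_measurable_glue[OF h_meas \<open>0 < K\<close>] by auto
  show "glue K (\<lambda>i u. if i < K then \<Sum>j<K. g ((real j + u) / real K) else 0) \<in> X"
    using glue_block_sum_mem[OF h_meas glue_h(1) \<open>0 < K\<close>] unfolding h_def by simp
  show "N (glue K (\<lambda>i u. if i < K then \<Sum>j<K. g ((real j + u) / real K) else 0)) \<le> real K * N g"
    using N_glue_block_sum_le[OF h_meas glue_h(1) \<open>0 < K\<close>] unfolding glue_h(2) unfolding h_def by simp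
qed

lemma riemann_sum_le_N:
  assumes g: "g \<in> X" "mono_on {0<..<1} g" "\<And>t. 0 \<le> g t" and v: "v \<in> {0<..<1}"
  shows "(\<Sum>j<m. g ((real j + v) / real (Suc m))) \<le> real (Suc m) * N g"
proof -
  define K where "K = Suc m"
  have "0 < K" by (simp add: K_def)
  define h where "h i u = g ((real i + u) / real K)" for i :: nat and u
  define S where "S = glue K (\<lambda>i u. if i < K then \<Sum>j<K. h j u else 0)"
  have S_mem_le: "S \<in> X" "N S \<le> real K * N g"
    unfolding S_def h_def using g(1) \<open>0 < K\<close>
    by (rule glue_translates_sum_mem, rule N_glue_translates_sum_le)
  have "AE t in M01. (\<Sum>j<m. h j v) \<le> \<bar>S t\<bar>"
  proof (rule AE_M01_blockI[OF \<open>0 < K\<close>])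
    fix i u assume i: "i < K" and u: "0 < u" "u < (1::real)"
    have "h j v \<le> h (Suc j) u" if "j < m" for j
      unfolding h_def
    proof (rule mono_onD[OF g(2)])
      show "(real (Suc j) + u) / real K \<in> {0<..<1}" "(real j + v) / real K \<in> {0<..<1}"
        using that u v block_point_less_1[of _ K] by (auto simp: K_def)
      show "(real j + v) / real K \<le> (real (Suc j) + u) / real K"
        using u v by (intro divide_right_mono) auto
    qed
    then have "(\<Sum>j<m. h j v) \<le> (\<Sum>j<m. h (Suc j) u)"
      by (intro sum_mono) auto
    also have "\<dots> \<le> (\<Sum>j<K. h j u)"
      using g(3) unfolding K_def sum.lessThan_Suc_shift by (simp add: h_def)
    finally show "(\<Sum>j<m. h j v) \<le> \<bar>S ((real i + u) / real K)\<bar>"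
      using i u \<open>0 < K\<close> by (simp add: S_def glue_block)
  qed
  then have "(\<Sum>j<m. h j v) \<le> N S"
    using g(3) by (intro const_le_N S_mem_le(1)) (auto simp: h_def intro: sum_nonneg)
  then show ?thesis
    using S_mem_le(2) by (simp add: h_def K_def)
qed

lemma integrable_block:
  assumes g: "g \<in> X" "mono_on {0<..<1} g" "\<And>t. 0 \<le> g t" and "i < m"
  shows "integrable M01 (\<lambda>u. g ((real i + u) / real (Suc m)))"
proof (rule M01.integrable_const_bound)
  show "AE u in M01. norm (g ((real i + u) / real (Suc m))) \<le> real (Suc m) * N g"
  proof (rule AE_M01I)
    fix u :: real assume u: "0 < u" "u < 1"
    have "norm (g ((real i + u) / real (Suc m))) = g ((real i + u) / real (Suc m))"
      using g(3) by simp
    also have "\<dots> \<le> (\<Sum>j<m. g ((real j + u) / real (Suc m)))"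
      using \<open>i < m\<close> g(3) by (intro member_le_sum) auto
    also have "\<dots> \<le> real (Suc m) * N g"
      using g u by (intro riemann_sum_le_N) auto
    finally show "norm (g ((real i + u) / real (Suc m))) \<le> real (Suc m) * N g" .
  qed
  show "(\<lambda>u. g ((real i + u) / real (Suc m))) \<in> borel_measurable M01"
    using mem_measurable[OF g(1)] \<open>i < m\<close> by (intro borel_measurable_block) auto
qed

lemma nn_integral_truncated_le_N:
  assumes g: "g \<in> X" "mono_on {0<..<1} g" "\<And>t. 0 \<le> g t"
  shows "(\<integral>\<^sup>+t. ennreal (indicator {..<1 - 1 / real (Suc m)} t * g t) \<partial>M01) \<le> ennreal (N g)"
proof -
  define K where "K = Suc m"
  have "0 < K" by (simp add: K_def)
  define h where "h i u = g ((real i + u) / real K)" for i :: nat and u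
  define I where "I = (\<Sum>i<m. integral\<^sup>L M01 (h i))"
  let ?T = "glue K (\<lambda>i u. if i < m then h i u else 0)"
  have sum_le: "(\<Sum>j<m. h j u) \<le> real K * N g" if "0 < u" "u < 1" for u
    using riemann_sum_le_N[OF g, of u m] that by (simp add: h_def K_def)
  have h_int: "integrable M01 (h i)" if "i < m" for i
    unfolding h_def[abs_def] K_def using g that by (rule integrable_block)
  have "has_bochner_integral M01 (\<lambda>u. if i < m then h i u else 0) (if i < m then integral\<^sup>L M01 (h i) else 0)" for i
    using h_int by (auto simp: has_bochner_integral_integrable)
  then have "has_bochner_integral M01 ?T ((\<Sum>i<K. if i < m then integral\<^sup>L M01 (h i) else 0) / real K)"
    using \<open>0 < K\<close> by (intro has_bochner_integral_glue) auto
  also have "(\<Sum>i<K. if i < m then integral\<^sup>L M01 (h i) else 0) = I"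
    unfolding I_def by (rule sum.mono_neutral_cong_right) (auto simp: K_def)
  finally have nn_integral_T: "(\<integral>\<^sup>+t. ennreal (?T t) \<partial>M01) = ennreal (I / real K)"
    using g(3) by (subst nn_integral_eq_integral) (auto simp: has_bochner_integral_iff glue_def[abs_def] h_def)
  have "I = (LINT u|M01. (\<Sum>i<m. h i u))"
    unfolding I_def using h_int by (subst Bochner_Integration.integral_sum) auto
  also have "\<dots> \<le> (LINT u|M01. real K * N g)"
    using h_int sum_le by (intro integral_mono_AE AE_M01I) auto
  finally have "I / real K \<le> N g"
    using \<open>0 < K\<close> by (simp add: M01.prob_space field_simps)
  moreover have "AE t in M01. indicator {..<1 - 1 / real K} t * g t = ?T t"
    unfolding h_def K_def by (rule AE_truncated_eq_glue)
  then have "(\<integral>\<^sup>+t. ennreal (indicator {..<1 - 1 / real K} t * g t) \<partial>M01) = (\<integral>\<^sup>+t. ennreal (?T t) \<partial>M01)"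
    by (intro nn_integral_cong_AE) (auto elim: eventually_mono)
  ultimately show ?thesis
    unfolding K_def[symmetric] nn_integral_T by (simp add: ennreal_leI)
qed

lemma nn_integral_increasing_le_N:
  assumes g: "g \<in> X" "mono_on {0<..<1} g" "\<And>t. 0 \<le> g t"
  shows "(\<integral>\<^sup>+t. ennreal (g t) \<partial>M01) \<le> ennreal (N g)"
  using nn_integral_truncated_tendsto[OF mem_measurable[OF g(1)] g(3)]
  by (rule LIMSEQ_le_const2) (use nn_integral_truncated_le_N[OF g] in blast)

lemma nn_integral_abs_le_N:
  assumes y: "y \<in> X"
  shows "(\<integral>\<^sup>+t. ennreal \<bar>y t\<bar> \<partial>M01) \<le> ennreal (N y)"
proof -
  have abs_meas: "(\<lambda>t. \<bar>y t\<bar>) \<in> borel_measurable M01"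
    using mem_measurable[OF y] by measurable
  obtain g where g: "g \<in> borel_measurable M01" and eq: "equimeasurable g (\<lambda>t. \<bar>y t\<bar>)"
    and increasing: "mono_on {0<..<1} g" and nonneg: "\<And>t. 0 \<le> g t"
    using increasing_rearrangement_exists[OF abs_meas] by auto
  have "(\<lambda>t. \<bar>y t\<bar>) \<in> X" "N (\<lambda>t. \<bar>y t\<bar>) = N y"
    using cong_abs_mem[OF y abs_meas] N_cong_abs[OF y abs_meas] by simp_all
  then have g_mem: "g \<in> X" "N g = N y"
    using equimeasurable_mem[OF _ g eq] N_equimeasurable[OF _ g eq] by simp_all
  have "(\<integral>\<^sup>+t. ennreal \<bar>y t\<bar> \<partial>M01) = (\<integral>\<^sup>+t. ennreal (g t) \<partial>M01)"
    using g abs_meas eq by (rule nn_integral_eq_if_equimeasurable[symmetric])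
  also have "\<dots> \<le> ennreal (N y)"
    using nn_integral_increasing_le_N[OF g_mem(1) increasing nonneg] by (simp add: g_mem(2))
  finally show ?thesis .
qed

lemma
  assumes y: "y \<in> X"
  shows integrable_mem: "integrable M01 y" and integral_abs_le_N: "(LINT t|M01. \<bar>y t\<bar>) \<le> N y"
proof -
  have "(\<integral>\<^sup>+t. ennreal (norm (y t)) \<partial>M01) < \<infinity>"
    using nn_integral_abs_le_N[OF y] by (simp add: le_less_trans ennreal_less_top)
  then show y_int: "integrable M01 y"
    using mem_measurable[OF y] by (intro integrableI_bounded)
  then have "ennreal (LINT t|M01. \<bar>y t\<bar>) \<le> ennreal (N y)"
    using nn_integral_abs_le_N[OF y] by (subst (asm) nn_integral_eq_integral) auto
  then show "(LINT t|M01. \<bar>y t\<bar>) \<le> N y"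
    using N_nonneg[OF y] by simp
qed

end

subsection \<open>Integrals over right end segments\<close>

lemma set_integral_glue:
  assumes h: "\<And>i. i < K \<Longrightarrow> integrable M01 (h i)" and "0 < K"
    and A: "A \<in> sets M01" and B: "\<And>i. i < K \<Longrightarrow> B i \<in> sets M01"
    and mem_iff: "\<And>i u. i < K \<Longrightarrow> 0 < u \<Longrightarrow> u < 1 \<Longrightarrow> (real i + u) / real K \<in> A \<longleftrightarrow> u \<in> B i"
  shows "(LINT t:A|M01. glue K h t) = (\<Sum>i<K. LINT u:B i|M01. h i u) / real K"
proof -
  define h' where "h' i u = indicator (B i) u * h i u" for i u
  have h': "integrable M01 (h' i)" if "i < K" for i
    using integrable_mult_indicator[OF B h] that by (simp add: h'_def[abs_def])
  have "glue K h \<in> borel_measurable M01" "glue K h' \<in> borel_measurable M01"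
    using h h' \<open>0 < K\<close> by (auto intro: borel_measurable_glue borel_measurable_integrable)
  moreover have "AE t in M01. indicator A t *\<^sub>R glue K h t = glue K h' t"
    using \<open>0 < K\<close> mem_iff by (intro AE_M01_blockI[of K]) (simp_all add: glue_block h'_def indicator_def)
  ultimately have "(LINT t:A|M01. glue K h t) = integral\<^sup>L M01 (glue K h')"
    unfolding set_lebesgue_integral_def using A by (intro integral_cong_AE) auto
  also have "\<dots> = (\<Sum>i<K. integral\<^sup>L M01 (h' i)) / real K"
    using h' \<open>0 < K\<close>
    by (intro has_bochner_integral_integral_eq has_bochner_integral_glue has_bochner_integral_integrable)
  finally show ?thesis
    by (simp add: h'_def[abs_def] set_lebesgue_integral_def)
qed

lemma set_integral_glue_last_blocks:
  assumes h: "\<And>i. i < K \<Longrightarrow> integrable M01 (h i)" and K: "K = M * P" "0 < M" "0 < P"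
  shows "(LINT t:{1 - 1 / real M..1}|M01. glue K h t) =
    (\<Sum>i\<in>{K - P..<K}. integral\<^sup>L M01 (h i)) / real K"
proof -
  have "0 < K" "P \<le> K" using K by auto
  have "(LINT t:{1 - 1 / real M..1}|M01. glue K h t) =
      (\<Sum>i<K. LINT u:(if K - P \<le> i then {0..1} else {})|M01. h i u) / real K"
  proof (rule set_integral_glue[OF h \<open>0 < K\<close>])
    fix i u assume i: "i < K" and u: "0 < u" "u < (1::real)"
    have "1 - 1 / real M = (real K - real P) / real K"
      using K by (simp add: field_simps)
    then have "1 - 1 / real M \<le> (real i + u) / real K \<longleftrightarrow> real K - real P \<le> real i + u"
      using \<open>0 < K\<close> by (simp add: divide_le_cancel)
    also have "\<dots> \<longleftrightarrow> K - P \<le> i"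
      using \<open>P \<le> K\<close> u by linarith
    finally show "(real i + u) / real K \<in> {1 - 1 / real M..1} \<longleftrightarrow> u \<in> (if K - P \<le> i then {0..1} else {})"
      using block_point_less_1[OF i u(2)] u by auto
  qed (use K sets_M01_right_end sets_M01_atLeastAtMost[of 0 1] in simp_all)
  also have "(\<Sum>i<K. LINT u:(if K - P \<le> i then {0..1} else {})|M01. h i u) =
      (\<Sum>i\<in>{K - P..<K}. LINT u:{0..1}|M01. h i u)"
    by (rule sum.mono_neutral_cong_right) (auto simp: set_lebesgue_integral_def)
  also have "\<dots> = (\<Sum>i\<in>{K - P..<K}. integral\<^sup>L M01 (h i))"
    unfolding set_lebesgue_integral_def
    by (intro sum.cong Bochner_Integration.integral_cong) (auto simp: space_M01)
  finally show ?thesis .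
qed

lemma set_integral_glue_last_block:
  assumes h: "\<And>i. i < K \<Longrightarrow> integrable M01 (h i)" and M: "M = K * J" "0 < K" "0 < J"
  shows "(LINT t:{1 - 1 / real M..1}|M01. glue K h t) =
    (LINT u:{1 - 1 / real J..1}|M01. h (K - 1) u) / real K"
proof -
  have "(LINT t:{1 - 1 / real M..1}|M01. glue K h t) =
      (\<Sum>i<K. LINT u:(if i = K - 1 then {1 - 1 / real J..1} else {})|M01. h i u) / real K"
  proof (rule set_integral_glue[OF h \<open>0 < K\<close>])
    fix i u assume i: "i < K" and u: "0 < u" "u < (1::real)"
    have "1 - 1 / real M = (real K - 1 / real J) / real K"
      using M by (simp add: field_simps)
    then have "1 - 1 / real M \<le> (real i + u) / real K \<longleftrightarrow> real K - 1 / real J \<le> real i + u"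
      using \<open>0 < K\<close> by (simp add: divide_le_cancel)
    also have "\<dots> \<longleftrightarrow> i = K - 1 \<and> 1 - 1 / real J \<le> u"
    proof (cases "i = K - 1")
      case True
      then show ?thesis using \<open>0 < K\<close> by (auto simp: of_nat_diff)
    next
      case False
      then have "real (Suc (Suc i)) \<le> real K"
        using i by (simp only: of_nat_le_iff)
      moreover have "1 / real J \<le> 1"
        using \<open>0 < J\<close> by simp
      ultimately show ?thesis
        using False u by simp
    qed
    finally show "(real i + u) / real K \<in> {1 - 1 / real M..1} \<longleftrightarrow>
        u \<in> (if i = K - 1 then {1 - 1 / real J..1} else {})"
      using block_point_less_1[OF i u(2)] u by auto
  qed (use M sets_M01_right_end[of M] sets_M01_right_end[of J] in simp_all)
  also have "(\<Sum>i<K. LINT u:(if i = K - 1 then {1 - 1 / real J..1} else {})|M01. h i u) =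
      (\<Sum>i<K. if i = K - 1 then LINT u:{1 - 1 / real J..1}|M01. h i u else 0)"
    by (intro sum.cong) (auto simp: set_lebesgue_integral_def)
  also have "\<dots> = (LINT u:{1 - 1 / real J..1}|M01. h (K - 1) u)"
    using \<open>0 < K\<close> by simp
  finally show ?thesis .
qed

lemma set_integral_right_end_le:
  fixes f :: "real \<Rightarrow> real"
  assumes f: "integrable M01 f" "antimono_on {0<..<1} f" and a: "0 < a" "a < 1"
  shows "(LINT t:{a..1}|M01. f t) \<le> (1 - a) * integral\<^sup>L M01 f"
proof -
  have interval: "{a..1} \<in> sets M01" "measure M01 {a..1} = 1 - a"
    using a by (simp_all add: sets_M01_atLeastAtMost measure_M01_atLeastAtMost)
  have ind: "integrable M01 (indicator {a..1} :: real \<Rightarrow> real)"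
    using interval(1) by (simp add: less_top[symmetric])
  have "(LINT t:{a..1}|M01. f t) \<le> (LINT t|M01. (1 - a) * f t + f a * (indicator {a..1} t - (1 - a)))"
    unfolding set_lebesgue_integral_def
  proof (rule integral_mono_AE)
    show "AE t in M01. indicator {a..1} t *\<^sub>R f t \<le> (1 - a) * f t + f a * (indicator {a..1} t - (1 - a))"
    proof (rule AE_M01I)
      fix t :: real assume t: "0 < t" "t < 1"
      have "(indicator {a..1} t - (1 - a)) * (f t - f a) \<le> 0"
      proof (cases "a \<le> t")
        case True
        then have "f t \<le> f a"
          using t a by (intro monotone_onD[OF f(2)]) auto
        then show ?thesis
          using True t a by (simp add: mult_nonneg_nonpos)
      next
        case False
        then have "f a \<le> f t"
          using t a by (intro monotone_onD[OF f(2)]) auto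
        then show ?thesis
          using False a by (simp add: mult_nonpos_nonneg)
      qed
      then show "indicator {a..1} t *\<^sub>R f t \<le> (1 - a) * f t + f a * (indicator {a..1} t - (1 - a))"
        by (simp add: algebra_simps)
    qed
  qed (use f(1) ind integrable_mult_indicator[OF interval(1) f(1)] in auto)
  also have "\<dots> = (1 - a) * integral\<^sup>L M01 f + f a * ((LINT t|M01. indicator {a..1} t) - (1 - a))"
    using f(1) ind by (simp add: M01.prob_space)
  also have "(LINT t|M01. indicator {a..1} t) = 1 - a"
    using interval by simp
  finally show ?thesis by simp
qed

subsection \<open>Nonnegative decreasing functions\<close>

definition nonneg_decreasing :: "(real \<Rightarrow> real) \<Rightarrow> bool" where
  "nonneg_decreasing f \<longleftrightarrow> (\<forall>t\<in>{0<..<1}. 0 \<le> f t) \<and> antimono_on {0<..<1} f"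

lemma nonneg_decreasing_nonneg: "nonneg_decreasing f \<Longrightarrow> 0 < t \<Longrightarrow> t < 1 \<Longrightarrow> 0 \<le> f t"
  by (simp add: nonneg_decreasing_def)

lemma nonneg_decreasing_antimono:
  "nonneg_decreasing f \<Longrightarrow> 0 < s \<Longrightarrow> s \<le> t \<Longrightarrow> t < 1 \<Longrightarrow> f t \<le> f s"
  by (auto simp: nonneg_decreasing_def monotone_on_def)

lemma nonneg_decreasing_integral_nonneg:
  "nonneg_decreasing f \<Longrightarrow> 0 \<le> integral\<^sup>L M01 f"
  by (intro integral_nonneg_AE AE_M01I nonneg_decreasing_nonneg)

lemma
  assumes [measurable]: "x \<in> borel_measurable M01" and t: "0 < t"
  shows drearr_nonneg: "0 \<le> drearr x t"
    and drearr_antimono: "t \<le> t' \<Longrightarrow> drearr x t' \<le> drearr x t"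
proof -
  define A where "A n = {u \<in> space M01. real n < \<bar>x u\<bar>}" for n
  have "(\<lambda>n. measure M01 (A n)) \<longlonglongrightarrow> measure M01 (\<Inter>n. A n)"
    by (intro M01.finite_Lim_measure_decseq) (auto simp: A_def decseq_def)
  moreover have "(\<Inter>n. A n) = {}"
    by (auto simp: A_def; metis reals_Archimedean2 order_less_asym)
  ultimately have "(\<lambda>n. measure M01 (A n)) \<longlonglongrightarrow> 0" by simp
  from order_tendstoD(2)[OF this t] obtain n where "measure M01 (A n) < t"
    by (auto simp: eventually_sequentially)
  then have nonempty: "{s. s \<ge> 0 \<and> measure M01 {u \<in> space M01. \<bar>x u\<bar> > s} \<le> t} \<noteq> {}"
    unfolding A_def by (auto intro!: exI[of _ "real n"])
  then show "0 \<le> drearr x t"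
    unfolding drearr_def by (rule cInf_greatest) auto
  show "drearr x t' \<le> drearr x t" if "t \<le> t'"
    unfolding drearr_def using nonempty that by (intro cInf_superset_mono bdd_belowI[of _ 0]) auto
qed

lemma nonneg_decreasing_if_eq_drearr:
  assumes "f \<in> borel_measurable M01" "\<forall>t\<in>{0..<1}. f t = drearr f t"
  shows "nonneg_decreasing f"
  unfolding nonneg_decreasing_def
  using assms by (auto intro!: monotone_onI drearr_nonneg drearr_antimono)

lemma set_lborel_integral_eq_M01:
  fixes f :: "real \<Rightarrow> real"
  assumes "antimono_on {0<..<1} f"
  shows "(LINT s:{0..1}|lborel. f s) = integral\<^sup>L M01 f"
proof -
  have "(\<lambda>t. - f t) \<in> borel_measurable (restrict_space borel {0<..<1})"
    using assms by (intro borel_measurable_mono_on_fnc) (auto simp: monotone_on_def)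
  then have "(\<lambda>t. - (indicator {0<..<1} t *\<^sub>R - f t)) \<in> borel_measurable borel"
    by (intro borel_measurable_uminus) (simp add: borel_measurable_restrict_space_iff)
  then have "(\<lambda>t. indicator {0..1} t *\<^sub>R f t) \<in> borel_measurable borel"
    by (rule measurable_discrete_difference[where X = "{0, 1}"]) (auto simp: indicator_def)
  then have "(LINT s:{0..1}|lborel. f s) = (LINT t|lebesgue. indicator {0..1} t *\<^sub>R f t)"
    unfolding set_lebesgue_integral_def by (intro integral_completion[symmetric]) simp
  also have "\<dots> = integral\<^sup>L M01 f"
    unfolding M01_def by (subst integral_restrict_space) auto
  finally show ?thesis .
qed

lemma dil_mono:
  assumes f: "nonneg_decreasing f" and "0 < \<sigma>" "\<sigma> \<le> \<tau>" "\<tau> \<le> 1"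
  shows "dil \<sigma> f t \<le> dil \<tau> f t"
proof (cases "0 < t \<and> t < \<sigma>")
  case True
  have "t / \<tau> \<le> t / \<sigma>"
    using True assms by (intro divide_left_mono) auto
  then have "f (t / \<sigma>) \<le> f (t / \<tau>)"
    using True assms by (intro nonneg_decreasing_antimono[OF f]) (auto simp: divide_less_eq)
  then show ?thesis
    using True assms by (simp add: dil_def)
next
  case False
  then show ?thesis
    using assms nonneg_decreasing_nonneg[OF f, of "t / \<tau>"] by (auto simp: dil_def)
qed

lemma dil_nonneg: "nonneg_decreasing f \<Longrightarrow> 0 < \<tau> \<Longrightarrow> \<tau> \<le> 1 \<Longrightarrow> 0 \<le> dil \<tau> f t"
  by (auto simp: dil_def intro: nonneg_decreasing_nonneg)

lemma AE_abs_dil_le: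
  assumes f: "nonneg_decreasing f" and \<tau>: "0 < \<tau>" "\<tau> \<le> 1"
  shows "AE t in M01. \<bar>dil \<tau> f t\<bar> \<le> \<bar>f t\<bar>"
proof (rule AE_M01I)
  fix t :: real assume "0 < t" "t < 1"
  then have "dil 1 f t = f t"
    by (simp add: dil_def)
  then show "\<bar>dil \<tau> f t\<bar> \<le> \<bar>f t\<bar>"
    using dil_nonneg[OF f \<tau>, of t] dil_mono[OF f \<tau>, of t] by simp
qed

context symm_space
begin

lemma dil_mem:
  assumes f: "f \<in> X" "nonneg_decreasing f" and \<tau>: "0 < \<tau>" "\<tau> \<le> 1"
  shows "dil \<tau> f \<in> X"
  using f(1) borel_measurable_dil[OF mem_measurable[OF f(1)] \<tau>] AE_abs_dil_le[OF f(2) \<tau>]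
  by (rule dominated_mem)

lemma N_dil_mono:
  assumes f: "f \<in> X" "nonneg_decreasing f" and \<tau>: "0 < \<sigma>" "\<sigma> \<le> \<tau>" "\<tau> \<le> 1"
  shows "N (dil \<sigma> f) \<le> N (dil \<tau> f)"
proof (rule N_mono)
  show "AE t in M01. \<bar>dil \<sigma> f t\<bar> \<le> \<bar>dil \<tau> f t\<bar>"
    using dil_nonneg[OF f(2)] dil_mono[OF f(2) \<tau>] \<tau> by (intro AE_I2) simp
qed (use f \<tau> in \<open>auto intro: dil_mem borel_measurable_dil mem_measurable\<close>)

lemma N_dil_eq_0:
  assumes f: "f \<in> X" "nonneg_decreasing f" and ae: "AE t in M01. f t = 0" and \<tau>: "0 < \<tau>" "\<tau> \<le> 1"
  shows "N (dil \<tau> f) = 0"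
proof -
  have "N (dil \<tau> f) \<le> N f"
    using f(1) borel_measurable_dil[OF mem_measurable[OF f(1)] \<tau>] AE_abs_dil_le[OF f(2) \<tau>]
    by (rule N_mono)
  then show ?thesis
    using ae N_eq_0_iff[OF f(1)] N_nonneg[OF dil_mem[OF f \<tau>]] by simp
qed

subsection \<open>The contribution of one level\<close>

lemma
  assumes f: "f \<in> borel_measurable M01" and "0 < K" and mem: "glue K (\<lambda>i u. c i * f u) \<in> X"
  shows glue_abs_reversed_mem: "glue K (\<lambda>i u. \<bar>c (K - Suc i)\<bar> * f u) \<in> X"
    and N_glue_abs_reversed:
      "N (glue K (\<lambda>i u. \<bar>c (K - Suc i)\<bar> * f u)) = N (glue K (\<lambda>i u. c i * f u))"
proof -
  have f_meas: "(\<lambda>u. a * f u) \<in> borel_measurable M01" for a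
    using f by measurable
  have "bij_betw (\<lambda>i. K - Suc i) {..<K} {..<K}"
    by (rule bij_betw_byWitness[where f' = "\<lambda>i. K - Suc i"]) auto
  then have reversed: "glue K (\<lambda>i u. c (K - Suc i) * f u) \<in> X"
      "N (glue K (\<lambda>i u. c (K - Suc i) * f u)) = N (glue K (\<lambda>i u. c i * f u))"
    using glue_permute_mem[OF f_meas mem \<open>0 < K\<close>] N_glue_permute[OF f_meas mem \<open>0 < K\<close>] by auto
  have abs_eq: "AE t in M01. \<bar>glue K (\<lambda>i u. \<bar>c (K - Suc i)\<bar> * f u) t\<bar> =
      \<bar>glue K (\<lambda>i u. c (K - Suc i) * f u) t\<bar>"
    by (simp add: glue_def abs_mult)
  have abs_meas: "glue K (\<lambda>i u. \<bar>c (K - Suc i)\<bar> * f u) \<in> borel_measurable M01"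
    using f_meas \<open>0 < K\<close> by (rule borel_measurable_glue)
  show "glue K (\<lambda>i u. \<bar>c (K - Suc i)\<bar> * f u) \<in> X"
    using reversed(1) abs_meas abs_eq by (rule cong_abs_mem)
  show "N (glue K (\<lambda>i u. \<bar>c (K - Suc i)\<bar> * f u)) = N (glue K (\<lambda>i u. c i * f u))"
    using N_cong_abs[OF reversed(1) abs_meas abs_eq] reversed(2) by simp
qed

lemma sum_abs_coeffs_N_dil_le:
  assumes f: "f \<in> X" "nonneg_decreasing f" and K: "K = M * P" "0 < M" "0 < P"
    and mem: "glue K (\<lambda>i u. c i * f u) \<in> X"
  shows "(\<Sum>i\<in>{K - P..<K}. \<bar>c i\<bar>) * N (dil (1 / real M) f) \<le> real P * N (glue K (\<lambda>i u. c i * f u))"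
proof -
  have "0 < K" "P \<le> K" using K by auto
  have f_meas: "(\<lambda>u. a * f u) \<in> borel_measurable M01" for a
    using mem_measurable[OF f(1)] by measurable
  let ?L = "glue K (\<lambda>i u. c i * f u)"
  define h where "h i u = \<bar>c (K - Suc i)\<bar> * f u" for i u
  have h_meas: "h i \<in> borel_measurable M01" for i
    unfolding h_def[abs_def] by (rule f_meas)
  have glue_h: "glue K h \<in> X" "N (glue K h) = N ?L"
    unfolding h_def using mem_measurable[OF f(1)] \<open>0 < K\<close> mem
    by (rule glue_abs_reversed_mem, rule N_glue_abs_reversed)
  define S where "S = (\<Sum>i\<in>{K - P..<K}. \<bar>c i\<bar>)"
  have "(\<Sum>j<P. \<bar>c (K - Suc j)\<bar>) = S"
    unfolding S_def
    by (rule sum.reindex_bij_witness[of _ "\<lambda>i. K - Suc i" "\<lambda>j. K - Suc j"]) (use \<open>P \<le> K\<close> in auto)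
  then have sum_h: "(\<Sum>j<P. h j u) = S * f u" for u
    by (simp add: h_def sum_distrib_right[symmetric])
  have averaged: "glue K (\<lambda>i u. if i < P then S * f u else 0) \<in> X"
      "N (glue K (\<lambda>i u. if i < P then S * f u else 0)) \<le> real P * N ?L"
    using glue_block_sum_mem[OF h_meas glue_h(1) \<open>0 < P\<close> \<open>P \<le> K\<close>]
      N_glue_block_sum_le[OF h_meas glue_h(1) \<open>0 < P\<close> \<open>P \<le> K\<close>] glue_h(2)
    unfolding sum_h by simp_all
  have "equimeasurable (dil (1 / real M) (\<lambda>u. S * f u)) (glue K (\<lambda>i u. if i < P then S * f u else 0))"
    unfolding K(1) using f_meas K(2,3) by (rule equimeasurable_dil)
  moreover have "dil (1 / real M) (\<lambda>u. S * f u) \<in> borel_measurable M01"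
    using f_meas K(2) by (intro borel_measurable_dil) auto
  ultimately have "N (dil (1 / real M) (\<lambda>u. S * f u)) \<le> real P * N ?L"
    using N_equimeasurable[OF averaged(1)] averaged(2) by simp
  moreover have "dil (1 / real M) (\<lambda>u. S * f u) = (\<lambda>t. S * dil (1 / real M) f t)"
    by (auto simp: dil_def)
  moreover have "N (\<lambda>t. S * dil (1 / real M) f t) = S * N (dil (1 / real M) f)"
    using N_cmult[OF dil_mem[OF f, of "1 / real M"], of S] K(2) by (simp add: S_def sum_nonneg)
  ultimately show ?thesis
    by (simp add: S_def)
qed

lemma N_dil_set_integral_glue_le_fine:
  assumes f: "f \<in> X" "nonneg_decreasing f" "integrable M01 f" and K: "K = M * P" "0 < M" "0 < P"
    and mem: "glue K (\<lambda>i u. c i * f u) \<in> X"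
  shows "N (dil (1 / real M) f) * \<bar>LINT t:{1 - 1 / real M..1}|M01. glue K (\<lambda>i u. c i * f u) t\<bar> \<le>
    integral\<^sup>L M01 f / real M * N (glue K (\<lambda>i u. c i * f u))"
proof -
  let ?F = "integral\<^sup>L M01 f" and ?D = "N (dil (1 / real M) f)" and ?L = "glue K (\<lambda>i u. c i * f u)"
  have F_nonneg: "0 \<le> ?F" using f(2) by (rule nonneg_decreasing_integral_nonneg)
  have D_nonneg: "0 \<le> ?D" using f K(2) by (intro N_nonneg dil_mem) auto
  have "(LINT t:{1 - 1 / real M..1}|M01. ?L t) = (\<Sum>i\<in>{K - P..<K}. c i * ?F) / real K"
    using f(3) K by (subst set_integral_glue_last_blocks[of K _ M P]) auto
  also have "\<dots> = (\<Sum>i\<in>{K - P..<K}. c i) * (?F / real K)"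
    by (simp add: sum_distrib_right)
  also have "\<bar>\<dots>\<bar> \<le> (\<Sum>i\<in>{K - P..<K}. \<bar>c i\<bar>) * (?F / real K)"
    using F_nonneg by (simp add: abs_mult mult_right_mono divide_right_mono)
  finally have "?D * \<bar>LINT t:{1 - 1 / real M..1}|M01. ?L t\<bar> \<le>
      ?D * ((\<Sum>i\<in>{K - P..<K}. \<bar>c i\<bar>) * (?F / real K))"
    using D_nonneg by (rule mult_left_mono)
  also have "\<dots> = ?F / real K * ((\<Sum>i\<in>{K - P..<K}. \<bar>c i\<bar>) * ?D)"
    by simp
  also have "\<dots> \<le> ?F / real K * (real P * N ?L)"
    using F_nonneg f K mem by (intro mult_left_mono sum_abs_coeffs_N_dil_le[of f K M P]) auto
  also have "\<dots> = ?F / real M * N ?L"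
    using K by simp
  finally show ?thesis .
qed

lemma N_dil_set_integral_glue_le_coarse:
  assumes f: "f \<in> X" "nonneg_decreasing f" "integrable M01 f" and M: "M = K * J" "0 < K" "1 < J"
    and mem: "glue K (\<lambda>i u. c i * f u) \<in> X"
  shows "N (dil (1 / real M) f) * \<bar>LINT t:{1 - 1 / real M..1}|M01. glue K (\<lambda>i u. c i * f u) t\<bar> \<le>
    integral\<^sup>L M01 f / real M * N (glue K (\<lambda>i u. c i * f u))"
proof -
  let ?F = "integral\<^sup>L M01 f" and ?D = "N (dil (1 / real M) f)" and ?L = "glue K (\<lambda>i u. c i * f u)"
  define I where "I = (LINT u:{1 - 1 / real J..1}|M01. f u)"
  have F_nonneg: "0 \<le> ?F" using f(2) by (rule nonneg_decreasing_integral_nonneg)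
  have "0 < M" using M by simp
  then have D_nonneg: "0 \<le> ?D" using f by (intro N_nonneg dil_mem) auto
  have "I \<le> (1 - (1 - 1 / real J)) * ?F"
    unfolding I_def using f M by (intro set_integral_right_end_le) (auto simp: nonneg_decreasing_def)
  then have I_le: "I \<le> ?F / real J"
    by simp
  have I_nonneg: "0 \<le> I"
    unfolding I_def set_lebesgue_integral_def
    using f(2) by (intro integral_nonneg_AE AE_M01I) (simp add: nonneg_decreasing_nonneg)
  have "(LINT t:{1 - 1 / real M..1}|M01. ?L t) = (LINT u:{1 - 1 / real J..1}|M01. c (K - 1) * f u) / real K"
    using f(3) M by (intro set_integral_glue_last_block) auto
  then have "\<bar>LINT t:{1 - 1 / real M..1}|M01. ?L t\<bar> = \<bar>c (K - 1)\<bar> * I / real K"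
    using I_nonneg by (simp add: I_def abs_mult)
  also have "\<dots> \<le> \<bar>c (K - 1)\<bar> * (?F / real J) / real K"
    using I_le by (intro divide_right_mono mult_left_mono) auto
  also have "\<dots> = ?F / real M * \<bar>c (K - 1)\<bar>"
    by (simp add: M(1) field_simps)
  finally have "?D * \<bar>LINT t:{1 - 1 / real M..1}|M01. ?L t\<bar> \<le> ?D * (?F / real M * \<bar>c (K - 1)\<bar>)"
    using D_nonneg by (rule mult_left_mono)
  also have "\<dots> = ?F / real M * (\<bar>c (K - 1)\<bar> * ?D)"
    by simp
  also have "\<dots> \<le> ?F / real M * (\<bar>c (K - 1)\<bar> * N (dil (1 / real K) f))"
    using F_nonneg f M by (intro mult_left_mono N_dil_mono frac_le) auto
  also have "\<dots> \<le> ?F / real M * N ?L"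
  proof (rule mult_left_mono)
    have "{K - 1..<K} = {K - 1}" using M(2) by auto
    then show "\<bar>c (K - 1)\<bar> * N (dil (1 / real K) f) \<le> N ?L"
      using sum_abs_coeffs_N_dil_le[OF f(1,2) _ M(2) zero_less_one mem] by simp
  qed (use F_nonneg in simp)
  finally show ?thesis .
qed

lemma N_dil_set_integral_glue_le:
  assumes f: "f \<in> X" "nonneg_decreasing f" "integrable M01 f"
    and "0 < K" "0 < M" and dvd: "K dvd M \<or> M dvd K"
    and mem: "glue K (\<lambda>i u. c i * f u) \<in> X"
  shows "N (dil (1 / real M) f) * \<bar>LINT t:{1 - 1 / real M..1}|M01. glue K (\<lambda>i u. c i * f u) t\<bar> \<le>
    integral\<^sup>L M01 f / real M * N (glue K (\<lambda>i u. c i * f u))"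
proof (cases "M dvd K")
  case True
  then obtain P where "K = M * P" ..
  with \<open>0 < K\<close> show ?thesis
    using f \<open>0 < M\<close> mem by (intro N_dil_set_integral_glue_le_fine) auto
next
  case False
  then obtain J where "M = K * J" using dvd by blast
  moreover have "J \<noteq> 1" using \<open>M = K * J\<close> False by auto
  ultimately show ?thesis
    using f \<open>0 < K\<close> \<open>0 < M\<close> mem by (intro N_dil_set_integral_glue_le_coarse) auto
qed

lemma N_dil_set_integral_level_sum_le:
  assumes f: "f \<in> X" "nonneg_decreasing f" "integrable M01 f" and mem: "level_sum \<xi> f k \<in> X"
  shows "N (dil (1 / 2 ^ n) f) * \<bar>LINT t:{1 - 1 / 2 ^ n..1}|M01. level_sum \<xi> f k t\<bar> \<le>
    integral\<^sup>L M01 f / 2 ^ n * N (level_sum \<xi> f k)"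
proof -
  obtain c where c: "AE t in M01. level_sum \<xi> f k t = glue (2 ^ k) (\<lambda>i u. c i * f u) t"
    by (rule level_sum_eq_glue)
  let ?G = "glue (2 ^ k) (\<lambda>i u. c i * f u)"
  have G_meas: "?G \<in> borel_measurable M01"
    using mem_measurable[OF f(1)] by (intro borel_measurable_glue) auto
  have "AE t in M01. \<bar>?G t\<bar> = \<bar>level_sum \<xi> f k t\<bar>"
    using c by eventually_elim simp
  then have G_mem_eq: "?G \<in> X" "N ?G = N (level_sum \<xi> f k)"
    using cong_abs_mem[OF mem G_meas] N_cong_abs[OF mem G_meas] by auto
  have "(LINT t:{1 - 1 / 2 ^ n..1}|M01. level_sum \<xi> f k t) = (LINT t:{1 - 1 / 2 ^ n..1}|M01. ?G t)"
    using c G_meas mem_measurable[OF mem] sets_M01_right_end[of "2 ^ n"]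
    by (intro set_lebesgue_integral_cong_AE) auto
  moreover have "(2 :: nat) ^ k dvd 2 ^ n \<or> (2 :: nat) ^ n dvd 2 ^ k"
    by (metis le_imp_power_dvd nat_le_linear)
  ultimately show ?thesis
    using N_dil_set_integral_glue_le[OF f _ _ _ G_mem_eq(1), of "2 ^ n"] by (simp add: G_mem_eq(2))
qed

end

subsection \<open>Integration of the representing series\<close>

lemma ex_dyadic_scale:
  assumes "0 < t" "t \<le> (1::real)"
  obtains n where "t \<le> 1 / 2 ^ n" "1 / 2 ^ n < 2 * t"
proof -
  have "1 \<le> nat \<lfloor>1 / t\<rfloor>"
    using assms by (simp add: le_nat_iff le_floor_iff)
  then obtain n where n: "2 ^ n \<le> nat \<lfloor>1 / t\<rfloor>" "nat \<lfloor>1 / t\<rfloor> < 2 ^ (n + 1)"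
    using ex_power_ivl1[of 2 "nat \<lfloor>1 / t\<rfloor>"] by auto
  have "2 ^ n \<le> 1 / t"
    using n(1) assms by (simp add: le_nat_iff le_floor_iff)
  moreover have "1 / t < 2 ^ (n + 1)"
    using n(2) assms by (simp add: nat_less_iff floor_less_iff)
  ultimately show ?thesis
    using assms by (intro that[of n]) (simp_all add: field_simps)
qed

lemma set_integral_indicator_self:
  assumes "A \<in> sets M"
  shows "(LINT t:A|M. indicator A t) = measure M A"
proof -
  have "(LINT t:A|M. indicator A t) = (LINT t|M. indicator A t)"
    unfolding set_lebesgue_integral_def
    by (intro Bochner_Integration.integral_cong) (auto simp: indicator_def)
  also have "\<dots> = measure M A"
    using assms by (simp add: sets.Int_space_eq2)
  finally show ?thesis .
qed

context nontrivial_symm_space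
begin

lemma abs_set_integral_le_N:
  assumes y: "y \<in> X" and A: "A \<in> sets M01"
  shows "\<bar>LINT t:A|M01. y t\<bar> \<le> N y"
proof -
  have "\<bar>LINT t:A|M01. y t\<bar> \<le> (LINT t|M01. \<bar>indicator A t *\<^sub>R y t\<bar>)"
    unfolding set_lebesgue_integral_def by (rule integral_abs_bound)
  also have "\<dots> \<le> (LINT t|M01. \<bar>y t\<bar>)"
    using integrable_mem[OF y] A
    by (intro integral_mono integrable_abs integrable_mult_indicator) (auto simp: indicator_def)
  also have "\<dots> \<le> N y"
    using y by (rule integral_abs_le_N)
  finally show ?thesis .
qed

lemma diff_sum_mem:
  fixes n :: nat
  assumes "x \<in> X" "\<And>k. u k \<in> X"
  shows "(\<lambda>t. x t - (\<Sum>k<n. u k t)) \<in> X"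
proof (induction n)
  case 0
  then show ?case
    using assms(1) by simp
next
  case (Suc n)
  have "(\<lambda>t. (x t - (\<Sum>k<n. u k t)) + (- 1) * u n t) \<in> X"
    by (intro add_mem cmult_mem Suc assms)
  then show ?case
    by (simp add: algebra_simps)
qed

lemma set_integral_sums:
  assumes x: "x \<in> X" and u: "\<And>k. u k \<in> X" and A: "A \<in> sets M01"
    and lim: "(\<lambda>n. N (\<lambda>t. x t - (\<Sum>k<n. u k t))) \<longlonglongrightarrow> 0"
  shows "(\<lambda>k. LINT t:A|M01. u k t) sums (LINT t:A|M01. x t)"
proof -
  have int: "integrable M01 (\<lambda>t. indicator A t *\<^sub>R y t)" if "y \<in> X" for y
    using A integrable_mem[OF that] by (rule integrable_mult_indicator)
  have remainder: "(LINT t:A|M01. x t) - (\<Sum>k<n. LINT t:A|M01. u k t) =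
      (LINT t:A|M01. x t - (\<Sum>k<n. u k t))" for n
  proof -
    have "(\<Sum>k<n. LINT t:A|M01. u k t) = (LINT t|M01. (\<Sum>k<n. indicator A t *\<^sub>R u k t))"
      unfolding set_lebesgue_integral_def by (intro Bochner_Integration.integral_sum[symmetric] int u)
    then show ?thesis
      unfolding set_lebesgue_integral_def scaleR_diff_right scaleR_sum_right
      by (subst Bochner_Integration.integral_diff)
        (simp_all only: Bochner_Integration.integrable_sum int x u)
  qed
  have norm_le: "norm ((\<Sum>k<n. LINT t:A|M01. u k t) - (LINT t:A|M01. x t)) \<le> N (\<lambda>t. x t - (\<Sum>k<n. u k t))" for n
    using abs_set_integral_le_N[OF diff_sum_mem[where u = u, OF x u] A]
    by (subst norm_minus_commute) (simp only: remainder real_norm_def)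
  have "(\<lambda>n. (\<Sum>k<n. LINT t:A|M01. u k t) - (LINT t:A|M01. x t)) \<longlonglongrightarrow> 0"
    using lim by (rule Lim_null_comparison[OF always_eventually[OF allI[OF norm_le]]])
  then show ?thesis
    unfolding sums_def by (rule LIM_zero_cancel)
qed

lemma indicator_interval_mem: "0 \<le> a \<Longrightarrow> b \<le> 1 \<Longrightarrow> indicator {a..b} \<in> X"
  using one_mem
  by (rule dominated_mem) (auto intro!: AE_M01I borel_measurable_M01I simp: indicator_def)

lemma N_indicator_interval:
  assumes "0 \<le> a" "a \<le> b" "b \<le> 1"
  shows "N (indicator {a..b}) = fundamental N (b - a)"
  unfolding fundamental_def
proof (rule N_equimeasurable)
  show "indicator {0..b - a} \<in> X"
    using assms by (intro indicator_interval_mem) auto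
  show "equimeasurable (indicator {a..b}) (indicator {0..b - a})"
    using assms by (intro equimeasurable_indicator)
      (auto simp: sets_M01_atLeastAtMost measure_M01_atLeastAtMost)
qed (simp add: borel_measurable_M01I)

lemma fundamental_mono:
  assumes "0 \<le> s" "s \<le> t" "t \<le> 1"
  shows "fundamental N s \<le> fundamental N t"
  unfolding fundamental_def
proof (rule N_mono)
  show "indicator {0..t} \<in> X"
    using assms by (intro indicator_interval_mem) auto
qed (use assms in \<open>auto intro!: borel_measurable_M01I simp: indicator_def\<close>)

lemma fundamental_le_double:
  assumes t: "0 < t" "t \<le> t'" "t' \<le> 2 * t" "t' \<le> 1"
  shows "fundamental N t' \<le> 2 * fundamental N t"
proof -
  have mem: "indicator {0..t} \<in> X" "indicator {t..t'} \<in> X"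
    using t by (auto intro!: indicator_interval_mem)
  have "fundamental N t' \<le> N (\<lambda>u. indicator {0..t} u + indicator {t..t'} u)"
    unfolding fundamental_def using add_mem[OF mem]
    by (rule N_mono) (auto intro!: borel_measurable_M01I simp: indicator_def)
  also have "\<dots> \<le> N (indicator {0..t}) + N (indicator {t..t'})"
    using mem by (rule N_triangle)
  also have "N (indicator {t..t'}) = fundamental N (t' - t)"
    using t by (intro N_indicator_interval) auto
  also have "\<dots> \<le> fundamental N t"
    using t by (intro fundamental_mono) auto
  finally show ?thesis
    by (simp add: fundamental_def)
qed

lemma abs_representing_const_nonneg:
  assumes "abs_representing X N f C"
  shows "0 \<le> C"
proof -
  obtain \<xi> where mem: "\<And>k. level_sum \<xi> f k \<in> X" and summ: "summable (\<lambda>k. N (level_sum \<xi> f k))"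
    and sum_N_le: "(\<Sum>k. N (level_sum \<xi> f k)) \<le> C * N (indicator {0..1})"
    using assms one_mem unfolding abs_representing_def by blast
  have "0 \<le> (\<Sum>k. N (level_sum \<xi> f k))"
    using summ N_nonneg[OF mem] by (rule suminf_nonneg)
  with sum_N_le show ?thesis
    by (simp add: N_one)
qed

lemma N_dil_dyadic_le:
  assumes f: "f \<in> X" "nonneg_decreasing f" and rep: "abs_representing X N f C"
  shows "N (dil (1 / 2 ^ n) f) \<le> C * integral\<^sup>L M01 f * fundamental N (1 / 2 ^ n)"
proof -
  let ?E = "{1 - 1 / 2 ^ n..1::real}" and ?F = "integral\<^sup>L M01 f" and ?D = "N (dil (1 / 2 ^ n) f)"
  have E_meas: "?E \<in> sets M01" "measure M01 ?E = 1 / 2 ^ n"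
    using sets_M01_right_end[of "2 ^ n"] by (simp_all add: measure_M01_atLeastAtMost)
  have E_mem: "indicator ?E \<in> X"
    by (rule indicator_interval_mem) auto
  obtain \<xi> where mem: "\<And>k. level_sum \<xi> f k \<in> X"
    and lim: "(\<lambda>m. N (\<lambda>t. indicator ?E t - (\<Sum>k<m. level_sum \<xi> f k t))) \<longlonglongrightarrow> 0"
    and summ: "summable (\<lambda>k. N (level_sum \<xi> f k))"
    and sum_N_le: "(\<Sum>k. N (level_sum \<xi> f k)) \<le> C * N (indicator ?E)"
    using rep E_mem unfolding abs_representing_def by blast
  have "(\<lambda>k. ?D * (LINT t:?E|M01. level_sum \<xi> f k t)) sums (?D * (LINT t:?E|M01. indicator ?E t))"
    using E_mem mem E_meas(1) lim by (intro sums_mult set_integral_sums)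
  then have integral_sums: "(\<lambda>k. ?D * (LINT t:?E|M01. level_sum \<xi> f k t)) sums (?D * (1 / 2 ^ n))"
    by (simp only: set_integral_indicator_self[OF E_meas(1)] E_meas(2))
  have N_sums: "(\<lambda>k. ?F / 2 ^ n * N (level_sum \<xi> f k)) sums (?F / 2 ^ n * (\<Sum>k. N (level_sum \<xi> f k)))"
    using summ by (intro sums_mult summable_sums)
  have "?D * (LINT t:?E|M01. level_sum \<xi> f k t) \<le> ?F / 2 ^ n * N (level_sum \<xi> f k)" for k
  proof -
    have "?D * (LINT t:?E|M01. level_sum \<xi> f k t) \<le> ?D * \<bar>LINT t:?E|M01. level_sum \<xi> f k t\<bar>"
      using f by (intro mult_left_mono N_nonneg dil_mem) auto
    also have "\<dots> \<le> ?F / 2 ^ n * N (level_sum \<xi> f k)"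
      using f integrable_mem[OF f(1)] mem by (rule N_dil_set_integral_level_sum_le)
    finally show ?thesis .
  qed
  then have "?D * (1 / 2 ^ n) \<le> ?F / 2 ^ n * (\<Sum>k. N (level_sum \<xi> f k))"
    using integral_sums N_sums by (rule sums_le)
  also have "\<dots> \<le> ?F / 2 ^ n * (C * N (indicator ?E))"
    using sum_N_le nonneg_decreasing_integral_nonneg[OF f(2)] by (intro mult_left_mono) auto
  also have "N (indicator ?E) = fundamental N (1 / 2 ^ n)"
    using N_indicator_interval[of "1 - 1 / 2 ^ n" 1] by simp
  finally show ?thesis
    by (simp add: field_simps)
qed

lemma N_dil_le:
  assumes f: "f \<in> X" "nonneg_decreasing f" and rep: "abs_representing X N f C" and t: "0 < t" "t \<le> 1"
  shows "N (dil t f) \<le> 2 * C * integral\<^sup>L M01 f * fundamental N t"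
proof -
  obtain n where n: "t \<le> 1 / 2 ^ n" "1 / 2 ^ n < 2 * t"
    using t by (rule ex_dyadic_scale)
  have "N (dil t f) \<le> N (dil (1 / 2 ^ n) f)"
    using f t n(1) by (intro N_dil_mono) auto
  also have "\<dots> \<le> C * integral\<^sup>L M01 f * fundamental N (1 / 2 ^ n)"
    using f rep by (rule N_dil_dyadic_le)
  also have "\<dots> \<le> C * integral\<^sup>L M01 f * (2 * fundamental N t)"
    using t n abs_representing_const_nonneg[OF rep] nonneg_decreasing_integral_nonneg[OF f(2)]
    by (intro mult_left_mono fundamental_le_double) auto
  finally show ?thesis by (simp add: mult_ac)
qed

end

theorem theorem3:
  fixes X :: "(real \<Rightarrow> real) set" and N :: "(real \<Rightarrow> real) \<Rightarrow> real"
    and f :: "real \<Rightarrow> real" and C :: real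
  assumes "symmetric_space X N" and "separable_symm X N"
    and "f \<in> X" and "\<forall>t\<in>{0..<1}. f t = drearr f t"
    and "abs_representing X N f C"
  shows "\<forall>t. 0 < t \<and> t \<le> 1 \<longrightarrow>
           N (dil t f) \<le> 2 * C * \<bar>LINT s:{0..1}|lborel. f s\<bar> * fundamental N t"
proof (intro allI impI, elim conjE)
  fix t :: real assume t: "0 < t" "t \<le> 1"
  interpret symm_space X N
    using assms(1) by (rule symm_space_if_symmetric_space)
  have decreasing: "nonneg_decreasing f"
    using mem_measurable[OF assms(3)] assms(4) by (rule nonneg_decreasing_if_eq_drearr)
  then have integral_f: "(LINT s:{0..1}|lborel. f s) = integral\<^sup>L M01 f" "0 \<le> integral\<^sup>L M01 f"
    by (simp_all add: nonneg_decreasing_def set_lborel_integral_eq_M01 nonneg_decreasing_integral_nonneg)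
  show "N (dil t f) \<le> 2 * C * \<bar>LINT s:{0..1}|lborel. f s\<bar> * fundamental N t"
  proof (cases "AE u in M01. f u = 0")
    case True
    then show ?thesis
      using N_dil_eq_0[OF assms(3) decreasing True t] integral_eq_zero_AE[OF True] by (simp add: integral_f)
  next
    case False
    then interpret nontrivial_symm_space X N
      using assms(3) by unfold_locales (rule one_mem_if_nonzero)
    show ?thesis
      using N_dil_le[OF assms(3) decreasing assms(5) t] integral_f by simp
  qed
qed

end
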